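(* There exist $\varepsilon_d>0$ and $C_d>0$, depending only on $d$, such that for all $\rho>0$, all $0<\varepsilon\le\varepsilon_d\rho$ and all $M\in\mathcal{M}_{D,d,\rho}$, the following holds. Let $\mathcal{P}\subset\mathbb{R}^D$ be a finite point cloud and $\tilde T=\{\tilde T_p\}_{p\in\mathcal{P}}$ be a family of $d$-dimensional linear subspaces of $\mathbb{R}^D$ such that - $\max_{p\in\mathcal{P}}d(p,M)\le\eta$; - $\max_{p\in\mathcal{P}}\angle(T_{\pi_M(p)}M,\tilde T_p)\le\sin\theta$; - $\mathcal{P}$ is $\varepsilon$-sparse, i.e. $d(p,\mathcal{P}\setminus\{p\})\ge\varepsilon$ for all $p\in\mathcal{P}$; - $\max_{x\in M}d(x,\mathcal{P})\le2\varepsilon$. If $\theta\le\varepsilon/(1140\rho)$ and $\eta\le\varepsilon^2/(1140\rho)$, then - $d_H\left(M,\mathrm{Del}^{\omega_*}(\mathcal{P},\tilde T)\right)\le C_d\,\varepsilon^2/\rho$; - $M$ and $\mathrm{Del}^{\omega_*}(\mathcal{P},\tilde T)$ are ambient isotopic.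
   Context: $\|\cdot\|$ is the Euclidean norm on $\mathbb{R}^D$, $d(x,A)$ the distance to a set, $d_H$ the Hausdorff distance; a simplicial complex is identified with its underlying subset of $\mathbb{R}^D$. $\mathrm{med}(M)=\{x:\exists a\ne b\in M,\ \|x-a\|=\|x-b\|=d(x,M)\}$, $\mathrm{reach}(M)=\inf_{p\in M}d(p,\mathrm{med}(M))$, and $\mathcal{M}_{D,d,\rho}$ is the set of compact connected $d$-dimensional submanifolds of $\mathbb{R}^D$ without boundary with reach at least $\rho$. $\pi_M$ is the nearest-point projection onto $M$, $T_pM$ the tangent space at $p$. For linear subspaces of the same dimension, $\angle(U,V)=\|\pi_U-\pi_V\|_{\mathrm{op}}$ is the sine of their largest principal angle. The parameters $\theta,\eta$ are nonnegative. Tangential Delaunay Complex. For a finite $\mathcal{P}\subset\mathbb{R}^D$ and a weight assignment $\omega:\mathcal{P}\to[0,\infty)$, let $d(x,p^\omega)^2=\|x-p\|^2-\omega(p)^2$, $\mathrm{Vor}^\omega(p)=\{x: d(x,p^\omega)^2\le d(x,q^\omega)^2\ \forall q\in\mathcal{P}\}$, $\mathrm{Vor}^\omega(\tau)=\bigcap_{p\in\tau}\mathrm{Vor}^\omega(p)$ for $\tau\subset\mathcal{P}$. $\mathrm{Del}^\omega(\mathcal{P})$ consists of the simplices $\tau\subset\mathcal P$ with $\mathrm{Vor}^\omega(\tau)\ne\emptyset$. Given a family $T=\{T_p\}_{p\in\mathcal{P}}$ of $d$-dimensional linear subspaces, identified with the affine spaces $p+T_p$, $\mathrm{Del}^\omega(\mathcal{P},T)$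 is the subcomplex of simplices $\tau$ with $\mathrm{Vor}^\omega(\tau)\cap\bigcup_{p\in\tau}(p+T_p)\ne\emptyset$. $\omega_*=\omega_{*\mathcal{P},T}$ is the weight assignment of Boissonnat and Ghosh, a function of $(\mathcal{P},T)$ only, which satisfies: there are $\varepsilon'_d,C'_d>0$ such that for all $\rho>0$, $\varepsilon\le\varepsilon'_d\rho$, $M\in\mathcal{M}_{D,d,\rho}$ and every $\mathcal{P}\subset M$ that is an $(\varepsilon,2\varepsilon)$-net of $M$ (i.e. $\varepsilon$-sparse with $\sup_{x\in M}d(x,\mathcal{P})\le2\varepsilon$), with $T=\{T_pM\}_{p\in\mathcal{P}}$, one has $d_H(M,\mathrm{Del}^{\omega_*}(\mathcal{P},T))\le C'_d\varepsilon^2/\rho$ and $M$ and $\mathrm{Del}^{\omega_*}(\mathcal{P},T)$ are ambient isotopic. In the claim, $\omega_*=\omega_{*\mathcal{P},\tilde T}$. *)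

theory Defs
  imports "HOL-Analysis.Analysis"
begin

text \<open>
  The constants of the theorem must not depend on the ambient dimension \<open>D\<close>, so \<open>D\<close> is quantified
  inside the statement and cannot be given by a type.  All spaces \<open>\<real>\<^sup>D\<close> are therefore realised as the
  coordinate subspaces \<open>eucl D\<close> of the inner product space of finitely supported real sequences, on
  which the sequence norm is the Euclidean norm (lemma \<open>norm_eucl\<close>).
\<close>

typedef fseq = "{f :: nat \<Rightarrow> real. finite {i. f i \<noteq> 0}}"
  morphisms coord Abs_fseq
  by (rule exI[of _ "\<lambda>_. 0"]) simp

setup_lifting type_definition_fseq

lemma finite_coord [simp]: "finite {i. coord x i \<noteq> 0}"
  using coord[of x] by simp

lemma fseq_eq_iff: "x = y \<longleftrightarrow> (\<forall>i. coord x i = coord y i)"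
  by (metis coord_inject ext)

instantiation fseq :: real_vector
begin

lift_definition zero_fseq :: fseq is "\<lambda>_. 0" by simp

lift_definition plus_fseq :: "fseq \<Rightarrow> fseq \<Rightarrow> fseq" is "\<lambda>f g i. f i + g i"
  subgoal for f g
    by (rule finite_subset[of _ "{i. f i \<noteq> 0} \<union> {i. g i \<noteq> 0}"]) auto
  done

lift_definition minus_fseq :: "fseq \<Rightarrow> fseq \<Rightarrow> fseq" is "\<lambda>f g i. f i - g i"
  subgoal for f g
    by (rule finite_subset[of _ "{i. f i \<noteq> 0} \<union> {i. g i \<noteq> 0}"]) auto
  done

lift_definition uminus_fseq :: "fseq \<Rightarrow> fseq" is "\<lambda>f i. - f i" by simp

lift_definition scaleR_fseq :: "real \<Rightarrow> fseq \<Rightarrow> fseq" is "\<lambda>r f i. r * f i"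
  subgoal for r f
    by (rule finite_subset[of _ "{i. f i \<noteq> 0}"]) auto
  done

instance
  by standard (transfer; auto simp: algebra_simps)+

end

lemmas coord_simps [simp] =
  zero_fseq.rep_eq plus_fseq.rep_eq minus_fseq.rep_eq uminus_fseq.rep_eq scaleR_fseq.rep_eq

instantiation fseq :: real_normed_vector
begin

definition norm_fseq :: "fseq \<Rightarrow> real" where
  "norm x = L2_set (coord x) {i. coord x i \<noteq> 0}"

definition sgn_fseq :: "fseq \<Rightarrow> fseq" where
  "sgn (x::fseq) = x /\<^sub>R norm x"

definition dist_fseq :: "fseq \<Rightarrow> fseq \<Rightarrow> real" where
  "dist (x::fseq) y = norm (x - y)"

definition uniformity_fseq :: "(fseq \<times> fseq) filter" where
  "uniformity = (INF e\<in>{0<..}. principal {(x::fseq, y). dist x y < e})"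

definition open_fseq :: "fseq set \<Rightarrow> bool" where
  "open (U::fseq set) \<longleftrightarrow> (\<forall>x\<in>U. \<forall>\<^sub>F (x', y) in uniformity. x' = x \<longrightarrow> y \<in> U)"

lemma norm_fseq_superset:
  assumes "finite A" "{i. coord x i \<noteq> 0} \<subseteq> A"
  shows "norm x = L2_set (coord x) A"
  unfolding norm_fseq_def L2_set_def using assms
  by (intro arg_cong[where f = sqrt] sum.mono_neutral_left) auto

instance
proof
  fix x y :: fseq and r :: real
  let ?A = "{i. coord x i \<noteq> 0} \<union> {i. coord y i \<noteq> 0}"
  show "norm x = 0 \<longleftrightarrow> x = 0"
    by (auto simp: norm_fseq_def L2_set_eq_0_iff fseq_eq_iff)
  have "norm (x + y) = L2_set (coord (x + y)) ?A"
    "norm x = L2_set (coord x) ?A" "norm y = L2_set (coord y) ?A"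
    by (rule norm_fseq_superset; force)+
  then show "norm (x + y) \<le> norm x + norm y"
    using L2_set_triangle_ineq[of "coord x" "coord y" ?A] by (simp add: L2_set_def)
  have "norm (r *\<^sub>R x) = L2_set (coord (r *\<^sub>R x)) {i. coord x i \<noteq> 0}"
    by (rule norm_fseq_superset) auto
  then show "norm (r *\<^sub>R x) = \<bar>r\<bar> * norm x"
    by (simp add: norm_fseq_def L2_set_def power_mult_distrib real_sqrt_mult
        flip: sum_distrib_left)
qed (simp_all add: sgn_fseq_def dist_fseq_def uniformity_fseq_def open_fseq_def)

end

instantiation fseq :: real_inner
begin

definition inner_fseq :: "fseq \<Rightarrow> fseq \<Rightarrow> real" where
  "inner x y = (\<Sum>i | coord x i \<noteq> 0. coord x i * coord y i)"

lemma inner_fseq_superset: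
  assumes "finite A" "{i. coord x i \<noteq> 0} \<subseteq> A"
  shows "inner x y = (\<Sum>i\<in>A. coord x i * coord y i)"
  unfolding inner_fseq_def using assms by (intro sum.mono_neutral_left) auto

instance
proof
  fix x y z :: fseq and r :: real
  let ?A = "{i. coord x i \<noteq> 0} \<union> {i. coord y i \<noteq> 0}"
  have "inner x y = (\<Sum>i\<in>?A. coord x i * coord y i)" "inner y x = (\<Sum>i\<in>?A. coord y i * coord x i)"
    by (rule inner_fseq_superset; force)+
  then show "inner x y = inner y x"
    by (simp add: mult.commute)
  have "inner (x + y) z = (\<Sum>i\<in>?A. coord (x + y) i * coord z i)"
    "inner x z = (\<Sum>i\<in>?A. coord x i * coord z i)" "inner y z = (\<Sum>i\<in>?A. coord y i * coord z i)"
    by (rule inner_fseq_superset; force)+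
  then show "inner (x + y) z = inner x z + inner y z"
    by (simp add: sum.distrib algebra_simps)
  have "inner (r *\<^sub>R x) y = (\<Sum>i | coord x i \<noteq> 0. coord (r *\<^sub>R x) i * coord y i)"
    by (rule inner_fseq_superset) auto
  then show "inner (r *\<^sub>R x) y = r * inner x y"
    by (simp add: inner_fseq_def sum_distrib_left mult.assoc)
  show "0 \<le> inner x x"
    by (simp add: inner_fseq_def sum_nonneg)
  show "inner x x = 0 \<longleftrightarrow> x = 0"
    by (auto simp: inner_fseq_def sum_nonneg_eq_0_iff fseq_eq_iff)
  show "norm x = sqrt (inner x x)"
    by (simp add: norm_fseq_def L2_set_def inner_fseq_def power2_eq_square)
qed

end

definition eucl :: "nat \<Rightarrow> fseq set" where
  "eucl D = {x. \<forall>i\<ge>D. coord x i = 0}"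

lemma norm_eucl:
  assumes "x \<in> eucl D"
  shows "norm x = sqrt (\<Sum>i<D. (coord x i)\<^sup>2)"
proof -
  have "{i. coord x i \<noteq> 0} \<subseteq> {..<D}"
    using assms by (force simp: eucl_def not_le[symmetric])
  then have "inner x x = (\<Sum>i<D. coord x i * coord x i)"
    by (intro inner_fseq_superset) auto
  then show ?thesis
    by (simp add: norm_eq_sqrt_inner power2_eq_square)
qed

lemma subspace_eucl: "subspace (eucl D)"
  by (auto simp: subspace_def eucl_def)

definition subspaces :: "nat \<Rightarrow> nat \<Rightarrow> fseq set set" where
  "subspaces D d = {U. subspace U \<and> U \<subseteq> eucl D \<and> dim U = d}"

text \<open>Distances are extended reals, so that the distance to the empty set is \<open>\<infinity>\<close>
  (the library's \<open>infdist\<close> gives \<open>0\<close>).\<close>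

definition edist :: "fseq \<Rightarrow> fseq set \<Rightarrow> ereal" where
  "edist x A = (INF a\<in>A. ereal (dist x a))"

definition hausdorff_dist :: "fseq set \<Rightarrow> fseq set \<Rightarrow> ereal" where
  "hausdorff_dist A B = max (SUP a\<in>A. edist a B) (SUP b\<in>B. edist b A)"

definition med :: "nat \<Rightarrow> fseq set \<Rightarrow> fseq set" where
  "med D M = {x \<in> eucl D. \<exists>a\<in>M. \<exists>b\<in>M. a \<noteq> b \<and>
     ereal (norm (x - a)) = edist x M \<and> ereal (norm (x - b)) = edist x M}"

definition reach :: "nat \<Rightarrow> fseq set \<Rightarrow> ereal" where
  "reach D M = (INF p\<in>M. edist p (med D M))"

text \<open>Submanifolds are embedded submanifolds of class \<open>C\<^sup>1\<close>, the least regularity for which tangent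
  spaces are defined; positive reach then forces \<open>C\<^sup>1\<^sup>,\<^sup>1\<close>.  They are given by local parametrisations
  that are \<open>C\<^sup>1\<close> immersions and homeomorphisms onto their image.  In \<open>C1_immersion\<close> only the
  restriction of the derivative to \<open>eucl d\<close> matters: its values elsewhere are arbitrary.\<close>

definition C1_immersion :: "nat \<Rightarrow> fseq set \<Rightarrow> (fseq \<Rightarrow> fseq) \<Rightarrow> bool" where
  "C1_immersion d W \<phi> \<longleftrightarrow> (\<exists>\<phi>' :: fseq \<Rightarrow> fseq \<Rightarrow>\<^sub>L fseq. continuous_on W \<phi>' \<and>
     (\<forall>w\<in>W. (\<phi> has_derivative blinfun_apply (\<phi>' w)) (at w within W) \<and>
             inj_on (blinfun_apply (\<phi>' w)) (eucl d)))"

definition submanifold :: "nat \<Rightarrow> nat \<Rightarrow> fseq set \<Rightarrow> bool" where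
  "submanifold D d M \<longleftrightarrow> M \<subseteq> eucl D \<and>
     (\<forall>p\<in>M. \<exists>U W \<phi> \<psi>. p \<in> U \<and> openin (top_of_set M) U \<and>
        openin (top_of_set (eucl d)) W \<and> homeomorphism W U \<phi> \<psi> \<and> C1_immersion d W \<phi>)"

definition manifolds :: "nat \<Rightarrow> nat \<Rightarrow> real \<Rightarrow> fseq set set" where
  "manifolds D d \<rho> = {M. submanifold D d M \<and> compact M \<and> connected M \<and> M \<noteq> {} \<and>
     ereal \<rho> \<le> reach D M}"

text \<open>The space of velocities at \<open>p\<close> of \<open>C\<^sup>1\<close> curves in \<open>M\<close>.\<close>

definition tangent_space :: "fseq set \<Rightarrow> fseq \<Rightarrow> fseq set" where
  "tangent_space M p = {v. \<exists>\<gamma> \<delta>. \<delta> > 0 \<and> \<gamma> C1_differentiable_on {-\<delta><..<\<delta>} \<and>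
     \<gamma> ` {-\<delta><..<\<delta>} \<subseteq> M \<and> \<gamma> 0 = p \<and> (\<gamma> has_vector_derivative v) (at (0::real))}"

definition nearest_point :: "fseq set \<Rightarrow> fseq \<Rightarrow> fseq" where
  "nearest_point M x = (THE y. y \<in> M \<and> ereal (dist x y) = edist x M)"

definition orth_proj :: "fseq set \<Rightarrow> fseq \<Rightarrow> fseq" where
  "orth_proj U x = (THE y. y \<in> U \<and> (\<forall>u\<in>U. inner (x - y) u = 0))"

text \<open>For subspaces of \<open>\<real>\<^sup>D\<close> both projections vanish on the orthogonal complement of \<open>\<real>\<^sup>D\<close>, so the
  operator norm over all sequences is the operator norm over \<open>\<real>\<^sup>D\<close>.\<close>

definition subspace_angle :: "fseq set \<Rightarrow> fseq set \<Rightarrow> real" where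
  "subspace_angle U V = onorm (\<lambda>x. orth_proj U x - orth_proj V x)"

definition vor :: "nat \<Rightarrow> fseq set \<Rightarrow> (fseq \<Rightarrow> real) \<Rightarrow> fseq \<Rightarrow> fseq set" where
  "vor D P \<omega> p = {x \<in> eucl D. \<forall>q\<in>P. (norm (x - p))\<^sup>2 - (\<omega> p)\<^sup>2 \<le> (norm (x - q))\<^sup>2 - (\<omega> q)\<^sup>2}"

definition vor_cell :: "nat \<Rightarrow> fseq set \<Rightarrow> (fseq \<Rightarrow> real) \<Rightarrow> fseq set \<Rightarrow> fseq set" where
  "vor_cell D P \<omega> \<tau> = (\<Inter>p\<in>\<tau>. vor D P \<omega> p)"

definition del :: "nat \<Rightarrow> fseq set \<Rightarrow> (fseq \<Rightarrow> real) \<Rightarrow> fseq set set" where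
  "del D P \<omega> = {\<tau>. \<tau> \<subseteq> P \<and> \<tau> \<noteq> {} \<and> vor_cell D P \<omega> \<tau> \<noteq> {}}"

definition tdel :: "nat \<Rightarrow> fseq set \<Rightarrow> (fseq \<Rightarrow> fseq set) \<Rightarrow> (fseq \<Rightarrow> real) \<Rightarrow> fseq set set" where
  "tdel D P T \<omega> = {\<tau> \<in> del D P \<omega>. vor_cell D P \<omega> \<tau> \<inter> (\<Union>p\<in>\<tau>. (+) p ` T p) \<noteq> {}}"

text \<open>The underlying set of a simplicial complex given by its vertex sets.  Adding the faces of the
  members of the complex does not change it.\<close>

definition carrier_of :: "fseq set set \<Rightarrow> fseq set" where
  "carrier_of K = (\<Union>\<tau>\<in>K. convex hull \<tau>)"

definition ambient_isotopic :: "nat \<Rightarrow> fseq set \<Rightarrow> fseq set \<Rightarrow> bool" where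
  "ambient_isotopic D A B \<longleftrightarrow> (\<exists>F :: real \<Rightarrow> fseq \<Rightarrow> fseq.
     continuous_on ({0..1} \<times> eucl D) (\<lambda>(t, x). F t x) \<and>
     (\<forall>t\<in>{0..1}. \<exists>G. homeomorphism (eucl D) (eucl D) (F t) G) \<and>
     (\<forall>x\<in>eucl D. F 0 x = x) \<and> F 1 ` A = B)"

definition eps_sparse :: "real \<Rightarrow> fseq set \<Rightarrow> bool" where
  "eps_sparse \<epsilon> P \<longleftrightarrow> (\<forall>p\<in>P. ereal \<epsilon> \<le> edist p (P - {p}))"

text \<open>A weight assignment is a function of the ambient dimension, the point cloud and the family of
  subspaces.  Families indexed by \<open>P\<close> are elements of \<open>P \<rightarrow>\<^sub>E subspaces D d\<close>, so weights depend on the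
  family over \<open>P\<close> only.  The predicate states the property of the weight assignment of
  Boissonnat and Ghosh through which it is specified.\<close>

type_synonym weights = "nat \<Rightarrow> fseq set \<Rightarrow> (fseq \<Rightarrow> fseq set) \<Rightarrow> fseq \<Rightarrow> real"

definition boissonnat_ghosh :: "nat \<Rightarrow> weights \<Rightarrow> bool" where
  "boissonnat_ghosh d \<omega> \<longleftrightarrow>
     (\<forall>D P T. finite P \<longrightarrow> P \<subseteq> eucl D \<longrightarrow> T \<in> P \<rightarrow>\<^sub>E subspaces D d \<longrightarrow> (\<forall>p\<in>P. 0 \<le> \<omega> D P T p)) \<and>
     (\<exists>\<epsilon>'>0. \<exists>C'>0. \<forall>D \<rho> \<epsilon> M P T.
        0 < \<rho> \<longrightarrow> 0 < \<epsilon> \<longrightarrow> \<epsilon> \<le> \<epsilon>' * \<rho> \<longrightarrow> M \<in> manifolds D d \<rho> \<longrightarrow>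
        finite P \<longrightarrow> P \<subseteq> M \<longrightarrow> eps_sparse \<epsilon> P \<longrightarrow> (SUP x\<in>M. edist x P) \<le> ereal (2 * \<epsilon>) \<longrightarrow>
        T = (\<lambda>p\<in>P. tangent_space M p) \<longrightarrow>
        hausdorff_dist M (carrier_of (tdel D P T (\<omega> D P T))) \<le> ereal (C' * \<epsilon>\<^sup>2 / \<rho>) \<and>
        ambient_isotopic D M (carrier_of (tdel D P T (\<omega> D P T))))"

end

theory Submission
  imports Defs
begin

text \<open>
  The hypotheses on \<open>(P, T)\<close> are reduced to the noiseless ones by interpolation.  Let \<open>c\<^sub>p\<close> be the point
  of \<open>M\<close> nearest to \<open>p\<close>, let \<open>A\<^sub>p\<close> be the projection onto \<open>T\<^sub>p\<close> minus the projection onto the tangent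
  space of \<open>M\<close> at \<open>c\<^sub>p\<close>, and let
  \<open>\<Phi> x = x + (\<Sum>p\<in>P. \<beta> (x - c\<^sub>p) \<cdot> (p - c\<^sub>p + A\<^sub>p (x - c\<^sub>p)))\<close>
  for a bump function \<open>\<beta>\<close> supported in the ball of radius \<open>\<epsilon> / 4\<close>.  Then \<open>M' = \<Phi> ` M\<close> passes through
  \<open>P\<close> with tangent spaces \<open>T\<close>.  Points of \<open>M\<close> that \<open>\<Phi>\<close> moves are close to \<open>P\<close> and the others stay
  fixed, so \<open>P\<close> is still a \<open>2\<epsilon>\<close>-covering of \<open>M'\<close>, without any loss in the constant.

  Reach at least \<open>\<rho>\<close> is equivalent to the estimate \<open>d (b - a, T\<^sub>a M) \<le> \<bar>b - a\<bar>\<^sup>2 / (2\<rho>)\<close>.  The bounds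
  on \<open>\<theta>\<close> and \<open>\<eta>\<close> make the derivative of \<open>\<Phi>\<close> Lipschitz with a constant of order \<open>1 / \<rho>\<close>, so this
  estimate carries over to \<open>M'\<close> with \<open>\<rho> / 4\<close> in place of \<open>\<rho>\<close>, and the property of Boissonnat and
  Ghosh applies to \<open>M'\<close>.
\<close>

section \<open>Finite-dimensional subspaces\<close>

lift_definition axis_fseq :: "nat \<Rightarrow> fseq" is "\<lambda>i j. if j = i then 1 else 0"
  by simp

lemma coord_axis_fseq [simp]: "coord (axis_fseq i) j = (if j = i then 1 else 0)"
  by (simp add: axis_fseq.rep_eq)

lemma norm_axis_fseq [simp]: "norm (axis_fseq i) = 1"
  by (simp add: norm_fseq_def)

lemma inner_axis_fseq [simp]: "inner (axis_fseq i) x = coord x i"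
  by (simp add: inner_fseq_def)

lemma coord_sum [simp]: "coord (sum f A) i = (\<Sum>a\<in>A. coord (f a) i)"
  by (induction A rule: infinite_finite_induct) auto

lemma abs_coord_le_norm: "\<bar>coord x i\<bar> \<le> norm x"
  using Cauchy_Schwarz_ineq2[of "axis_fseq i" x] by simp

lemma eucl_expansion:
  assumes "x \<in> eucl D"
  shows "x = (\<Sum>i<D. coord x i *\<^sub>R axis_fseq i)"
proof -
  have "coord x j = coord (\<Sum>i<D. coord x i *\<^sub>R axis_fseq i) j" for j
    using assms by (auto simp: eucl_def if_distrib[of "(*) _"] sum.delta cong: if_cong)
  then show ?thesis
    using fseq_eq_iff by blast
qed

lemma axis_fseq_in_eucl [simp]: "axis_fseq i \<in> eucl D \<longleftrightarrow> i < D"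
  by (auto simp: eucl_def)

lemma zero_in_eucl [simp]: "0 \<in> eucl D"
  by (simp add: eucl_def)

lemmas eucl_add = subspace_add[OF subspace_eucl]
lemmas eucl_diff = subspace_diff[OF subspace_eucl]
lemmas eucl_scale = subspace_scale[OF subspace_eucl]
lemmas eucl_sum = subspace_sum[OF subspace_eucl]

lemma span_axis_fseq: "span (axis_fseq ` {..<D}) = eucl D"
proof
  show "span (axis_fseq ` {..<D}) \<subseteq> eucl D"
    by (rule span_minimal) (auto simp: subspace_eucl)
  show "eucl D \<subseteq> span (axis_fseq ` {..<D})"
  proof
    fix x assume "x \<in> eucl D"
    then have "x = (\<Sum>i<D. coord x i *\<^sub>R axis_fseq i)"
      by (rule eucl_expansion)
    also have "\<dots> \<in> span (axis_fseq ` {..<D})"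
      by (intro span_sum span_scale span_base) auto
    finally show "x \<in> span (axis_fseq ` {..<D})" .
  qed
qed

lemma inj_axis_fseq: "inj axis_fseq"
proof (rule injI)
  fix i j assume "axis_fseq i = axis_fseq j"
  then have "coord (axis_fseq i) i = coord (axis_fseq j) i" by simp
  then show "i = j" by (simp split: if_splits)
qed

lemma independent_axis_fseq: "independent (axis_fseq ` A)"
proof (rule pairwise_orthogonal_independent)
  show "pairwise orthogonal (axis_fseq ` A)"
    by (auto simp: pairwise_def orthogonal_def)
  show "0 \<notin> axis_fseq ` A"
    using norm_axis_fseq by (metis imageE norm_zero zero_neq_one)
qed

lemma dim_eucl [simp]: "dim (eucl D) = D"
proof -
  have "dim (eucl D) = card (axis_fseq ` {..<D})"
    by (rule dim_eq_card) (simp_all add: span_axis_fseq independent_axis_fseq span_eq_iff[THEN iffD2] subspace_eucl)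
  also have "\<dots> = D"
    using inj_axis_fseq by (simp add: card_image inj_on_subset)
  finally show ?thesis .
qed

text \<open>\<open>fseq\<close> is infinite-dimensional, so the finiteness of a basis has to come
  from the exchange bound against the \<open>D\<close> coordinate axes that span
  \<open>eucl D\<close>.\<close>

lemma finite_basis_in_eucl:
  assumes "U \<subseteq> eucl D" "subspace U"
  obtains B where "finite B" "independent B" "span B = U" "card B = dim U"
proof -
  obtain B where B: "B \<subseteq> U" "independent B" "U \<subseteq> span B" "card B = dim U"
    by (rule basis_exists)
  have "finite B"
    using independent_span_bound[of "axis_fseq ` {..<D}" B] B assms
    by (auto simp: span_axis_fseq)
  moreover have "span B = U"
    using B assms by (meson antisym span_minimal)
  ultimately show ?thesis
    using that B by blast
qed

text \<open>A vector of \<open>V\<close> outside \<open>U\<close> would extend a basis of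
  \<open>U\<close> to an independent subset of \<open>V\<close> with more than \<open>dim V\<close>
  elements.\<close>

lemma subspace_eq_if_dim_eq:
  assumes "U \<subseteq> V" "subspace U" "subspace V" "V \<subseteq> eucl D" "dim U = dim V"
  shows "U = V"
proof (rule ccontr)
  assume "U \<noteq> V"
  then obtain v where v: "v \<in> V" "v \<notin> U"
    using assms(1) by blast
  obtain A where A: "finite A" "independent A" "span A = U" "card A = dim U"
    using finite_basis_in_eucl[of U D] assms by blast
  obtain B where B: "finite B" "independent B" "span B = V" "card B = dim V"
    using finite_basis_in_eucl[of V D] assms by blast
  have "independent (insert v A)"
    using A v by (auto simp: independent_insert)
  moreover have "insert v A \<subseteq> span B"
    using A B v assms(1) span_superset[of A] by auto
  ultimately have "card (insert v A) \<le> card B"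
    using independent_span_bound[OF B(1)] by blast
  moreover have "v \<notin> A"
    using v A span_superset by blast
  ultimately show False
    using A B assms by simp
qed

lemma dim_inj_image_eucl:
  assumes "linear f" "inj_on f U" "subspace U" "U \<subseteq> eucl D"
  shows "dim (f ` U) = dim U"
proof -
  obtain B where B: "finite B" "independent B" "span B = U" "card B = dim U"
    using finite_basis_in_eucl[of U D] assms by blast
  have "independent (f ` B)"
    using B assms by (intro linear_independent_injective_image) auto
  moreover have "span (f ` B) = f ` U"
    using B linear_span_image[OF assms(1)] by simp
  ultimately have "dim (f ` U) = card (f ` B)"
    by (metis dim_span_eq_card_independent)
  also have "\<dots> = card B"
    using assms B span_superset[of B] by (intro card_image) (auto intro: inj_on_subset)
  finally show ?thesis using B by simp
qed

text \<open>Heine-Borel for the coordinate subspaces. Boxes are compact by induction on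
  \<open>D\<close>, each being a continuous image of the previous one times an interval, and a ball
  is a closed part of a box.\<close>

lemma compact_cball_eucl: "compact (cball a r \<inter> eucl D)"
proof -
  have box: "compact {x \<in> eucl D. \<forall>i<D. \<bar>coord x i\<bar> \<le> R}" for R
  proof (induction D)
    case 0
    have "{x \<in> eucl 0. \<forall>i<0. \<bar>coord x i\<bar> \<le> R} = {0}"
      by (auto simp: eucl_def fseq_eq_iff)
    then show ?case by simp
  next
    case (Suc D)
    let ?K = "{x \<in> eucl D. \<forall>i<D. \<bar>coord x i\<bar> \<le> R}"
    have "{x \<in> eucl (Suc D). \<forall>i<Suc D. \<bar>coord x i\<bar> \<le> R}
      = (\<lambda>(x, t). x + t *\<^sub>R axis_fseq D) ` (?K \<times> {-R..R})" (is "?L = ?R")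
    proof
      show "?L \<subseteq> ?R"
      proof
        fix x assume x: "x \<in> ?L"
        let ?y = "x - coord x D *\<^sub>R axis_fseq D"
        have "?y \<in> ?K"
          using x by (auto simp: eucl_def less_Suc_eq Suc_le_eq less_le)
        moreover have "coord x D \<in> {-R..R}"
          using x by (auto simp: abs_le_iff)
        moreover have "x = (\<lambda>(x, t). x + t *\<^sub>R axis_fseq D) (?y, coord x D)"
          by simp
        ultimately show "x \<in> ?R" by blast
      qed
      show "?R \<subseteq> ?L"
        by (auto simp: eucl_def less_Suc_eq)
    qed
    moreover have "compact ?R"
      using Suc by (intro compact_continuous_image compact_Times)
        (auto simp: case_prod_unfold intro!: continuous_intros)
    ultimately show ?case by simp
  qed
  have "cball a r \<inter> eucl D = {x \<in> eucl D. \<forall>i<D. \<bar>coord x i\<bar> \<le> norm a + r} \<inter> cball a r"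
  proof -
    have "\<bar>coord x i\<bar> \<le> norm a + r" if "x \<in> cball a r" for x i
      using that abs_coord_le_norm[of x i] norm_triangle_sub[of x a]
      by (simp add: dist_norm norm_minus_commute)
    then show ?thesis by blast
  qed
  then show ?thesis
    using compact_Int_closed[OF box, of "cball a r"] by simp
qed

text \<open>A Cauchy sequence stays in one compact ball. Completeness is what the Banach fixed point
  theorem asks for in \<open>homeomorphism_eucl\<close>.\<close>

lemma complete_eucl: "complete (eucl D)"
proof (rule completeI)
  fix f :: "nat \<Rightarrow> fseq" assume f: "\<forall>n. f n \<in> eucl D" "Cauchy f"
  have "bounded (range f)"
    using f cauchy_imp_bounded by blast
  then obtain r where "\<forall>x\<in>range f. norm x \<le> r"
    by (auto simp: bounded_iff)
  then have "\<forall>n. f n \<in> cball 0 r \<inter> eucl D"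
    using f by simp
  then show "\<exists>l\<in>eucl D. f \<longlonglongrightarrow> l"
    using compact_imp_complete[OF compact_cball_eucl] f(2) by (meson IntE completeE)
qed

lemma closed_eucl: "closed (eucl D)"
  by (rule complete_imp_closed[OF complete_eucl])

section \<open>Orthogonal decompositions and projections\<close>

definition orth_decomp :: "'a::real_inner set \<Rightarrow> bool" where
  "orth_decomp U \<longleftrightarrow> (\<forall>x. \<exists>y\<in>U. \<forall>u\<in>U. inner (x - y) u = 0)"

text \<open>One Gram-Schmidt step: \<open>n\<close> is the part of \<open>a\<close> orthogonal to
  the span of \<open>B\<close>, and the projection of \<open>x\<close> gains its component along
  \<open>n\<close>. No ambient \<open>eucl D\<close> occurs, so the lemma also serves images of
  derivatives in \<open>chart_tangent_space\<close>.\<close>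

lemma orth_decomp_span:
  assumes "finite B"
  shows "orth_decomp (span B)"
  using assms
proof (induction B)
  case empty
  then show ?case by (simp add: orth_decomp_def)
next
  case (insert a B)
  obtain b where b: "b \<in> span B" "\<And>u. u \<in> span B \<Longrightarrow> inner (a - b) u = 0"
    using insert unfolding orth_decomp_def by blast
  define n where "n = a - b"
  show ?case
    unfolding orth_decomp_def
  proof
    fix x
    obtain y where y: "y \<in> span B" "\<And>u. u \<in> span B \<Longrightarrow> inner (x - y) u = 0"
      using insert unfolding orth_decomp_def by blast
    \<comment> \<open>If \<open>a\<close> already lies in the span of \<open>B\<close>, then
      \<open>n = 0\<close> and the quotient is \<open>0 / 0 = 0\<close>, so that
      \<open>z = y\<close>.\<close>
    define z where "z = y + (inner (x - y) n / inner n n) *\<^sub>R n"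
    have "b \<in> span (insert a B)" "y \<in> span (insert a B)" "a \<in> span (insert a B)"
      using b y span_mono[of B "insert a B"] by (auto intro: span_base)
    then have "z \<in> span (insert a B)"
      unfolding z_def n_def by (intro span_add span_scale span_diff)
    moreover have "inner (x - z) u = 0" if u: "u \<in> span (insert a B)" for u
    proof -
      obtain k where k: "u - k *\<^sub>R a \<in> span B"
        using u span_breakdown_eq by blast
      define w where "w = (u - k *\<^sub>R a) + k *\<^sub>R b"
      have w: "w \<in> span B"
        unfolding w_def using k b by (intro span_add span_scale)
      have "u = w + k *\<^sub>R n"
        by (simp add: w_def n_def algebra_simps)
      moreover have "inner (x - z) w = 0"
        using y(2)[OF w] b(2)[OF w] by (simp add: z_def n_def inner_diff_left inner_add_left)
      moreover have "inner (x - z) n = 0"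
        by (cases "n = 0") (simp_all add: z_def inner_diff_left inner_add_left)
      ultimately show ?thesis
        by (simp add: inner_add_right)
    qed
    ultimately show "\<exists>y\<in>span (insert a B). \<forall>u\<in>span (insert a B). inner (x - y) u = 0"
      by blast
  qed
qed

lemma orth_decomp_eucl:
  assumes "U \<subseteq> eucl D" "subspace U"
  shows "orth_decomp U"
  using finite_basis_in_eucl[OF assms] orth_decomp_span by metis

text \<open>The difference of two candidates lies in \<open>U\<close>, hence is orthogonal to both
  residuals and so to itself. Every later fact on \<open>orth_proj\<close> is read off through this
  criterion.\<close>

lemma orth_proj_unique:
  assumes "subspace U" "y \<in> U" "\<And>u. u \<in> U \<Longrightarrow> inner (x - y) u = 0"
  shows "orth_proj U x = y"
  unfolding orth_proj_def
proof (rule the_equality)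
  show "y \<in> U \<and> (\<forall>u\<in>U. inner (x - y) u = 0)"
    using assms by blast
  fix z assume z: "z \<in> U \<and> (\<forall>u\<in>U. inner (x - z) u = 0)"
  then have "z - y \<in> U"
    using assms by (simp add: subspace_diff)
  then have "inner (x - y) (z - y) = 0" "inner (x - z) (z - y) = 0"
    using assms z by auto
  then have "inner (z - y) (z - y) = 0"
    by (simp add: inner_diff_left)
  then show "z = y" by simp
qed

context
  fixes U :: "fseq set" and D :: nat
  assumes U: "U \<subseteq> eucl D" "subspace U"
begin

lemma orth_proj_in: "orth_proj U x \<in> U"
  and inner_orth_proj: "u \<in> U \<Longrightarrow> inner (x - orth_proj U x) u = 0"
proof -
  obtain y where y: "y \<in> U" "\<forall>u\<in>U. inner (x - y) u = 0"
    using orth_decomp_eucl[OF U] unfolding orth_decomp_def by blast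
  then have "orth_proj U x = y"
    by (intro orth_proj_unique) (auto simp: U)
  then show "orth_proj U x \<in> U" "u \<in> U \<Longrightarrow> inner (x - orth_proj U x) u = 0"
    using y by auto
qed

lemma orth_proj_id: "x \<in> U \<Longrightarrow> orth_proj U x = x"
  by (rule orth_proj_unique) (auto simp: U)

lemma bounded_linear_orth_proj: "bounded_linear (orth_proj U)"
proof (rule bounded_linear_intro)
  show "orth_proj U (x + y) = orth_proj U x + orth_proj U y" for x y
  proof (rule orth_proj_unique)
    fix u assume "u \<in> U"
    then show "inner (x + y - (orth_proj U x + orth_proj U y)) u = 0"
      using inner_orth_proj[of u x] inner_orth_proj[of u y]
      by (simp add: inner_diff_left inner_add_left)
  qed (auto simp: U orth_proj_in subspace_add)
  show "orth_proj U (r *\<^sub>R x) = r *\<^sub>R orth_proj U x" for r x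
  proof (rule orth_proj_unique)
    fix u assume "u \<in> U"
    then show "inner (r *\<^sub>R x - r *\<^sub>R orth_proj U x) u = 0"
      using inner_orth_proj[of u x] by (simp flip: scaleR_diff_right)
  qed (auto simp: U orth_proj_in subspace_scale)
  show "norm (orth_proj U x) \<le> norm x * 1" for x
  proof -
    have "inner (x - orth_proj U x) (orth_proj U x) = 0"
      by (rule inner_orth_proj[OF orth_proj_in])
    then have "(norm (orth_proj U x))\<^sup>2 = inner x (orth_proj U x)"
      by (simp add: power2_norm_eq_inner inner_diff_left)
    also have "\<dots> \<le> norm x * norm (orth_proj U x)"
      by (rule norm_cauchy_schwarz)
    finally show ?thesis
      by (cases "orth_proj U x = 0") (auto simp: power2_eq_square)
  qed
qed

end

section \<open>Sets of positive reach\<close>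

text \<open>The two notions of distance part only at the empty set, which the hypothesis excludes.
  This is the bridge from the definitions to real-valued arguments.\<close>

lemma edist_eq_infdist:
  assumes "A \<noteq> {}"
  shows "edist x A = ereal (infdist x A)"
proof -
  have "bdd_below (dist x ` A)"
    by (rule bdd_belowI2[of _ 0]) simp
  then have "ereal (Inf (dist x ` A)) = (INF a\<in>dist x ` A. ereal a)"
    using assms by (intro ereal_Inf') auto
  then show ?thesis
    using assms by (simp add: edist_def infdist_def image_image)
qed

lemma compact_infdist_attained:
  assumes "compact A" "A \<noteq> {}"
  obtains a where "a \<in> A" "infdist x A = dist x a"
proof -
  have "continuous_on A (dist x)"
    by (intro continuous_intros)
  then obtain a where a: "a \<in> A" "\<And>b. b \<in> A \<Longrightarrow> dist x a \<le> dist x b"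
    using continuous_attains_inf[OF assms] by blast
  then have "infdist x A = dist x a"
    unfolding infdist_notempty[OF assms(2)] by (intro cInf_eq_minimum) auto
  then show ?thesis using a that by blast
qed

lemma norm_add_scaleR_power2:
  fixes x y :: "'a::real_inner"
  shows "(norm (x + s *\<^sub>R y))\<^sup>2 = (norm x)\<^sup>2 + 2 * s * inner y x + s\<^sup>2 * (norm y)\<^sup>2"
  unfolding power2_norm_eq_inner
  by (simp add: inner_add_left inner_add_right inner_commute power2_eq_square algebra_simps)

context
  fixes D :: nat and M :: "fseq set" and \<rho> :: real
  assumes M: "compact M" "M \<noteq> {}" "M \<subseteq> eucl D" and reach: "ereal \<rho> \<le> reach D M"
begin

text \<open>Two nearest points would place \<open>x\<close> on the medial axis, closer than
  \<open>\<rho>\<close> to a point of \<open>M\<close>.\<close>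

lemma nearest_unique:
  assumes x: "x \<in> eucl D" "infdist x M < \<rho>"
    and ab: "a \<in> M" "b \<in> M" "dist x a = infdist x M" "dist x b = infdist x M"
  shows "a = b"
proof (rule ccontr)
  assume "a \<noteq> b"
  then have "x \<in> med D M"
    using x ab M by (auto simp: med_def edist_eq_infdist dist_norm)
  then have "edist a (med D M) \<le> ereal (dist a x)"
    by (auto simp: edist_def intro: INF_lower)
  moreover have "reach D M \<le> edist a (med D M)"
    using ab by (auto simp: reach_def intro: INF_lower)
  ultimately have "ereal \<rho> \<le> ereal (dist a x)"
    using reach by (meson order.trans)
  then show False
    using ab x by (simp add: dist_commute)
qed

text \<open>The distance to \<open>M\<close> has slope \<open>1\<close> at every point of the tube: nearest points depend
  continuously on the base point, so moving away from the nearest point gains almost the full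
  step.\<close>

lemma infdist_slope:
  assumes x: "x \<in> eucl D" "0 < infdist x M" "infdist x M < \<rho>" and c: "0 < c" "c < 1" and e: "0 < e"
  obtains z where "z \<in> eucl D" "z \<noteq> x" "dist z x < e" "infdist z M \<ge> infdist x M + c * dist z x"
proof -
  define \<delta> where "\<delta> = infdist x M"
  obtain b where b: "b \<in> M" "\<delta> = dist x b"
    using compact_infdist_attained[OF M(1,2)] unfolding \<delta>_def by metis
  define u where "u = (x - b) /\<^sub>R \<delta>"
  have \<delta>: "0 < \<delta>" "norm (x - b) = \<delta>"
    using x b by (auto simp: \<delta>_def dist_norm)
  have u: "norm u = 1" "inner u (x - b) = \<delta>" "u \<in> eucl D"
    using \<delta> b M(3) x by (auto simp: u_def power2_norm_eq_inner[symmetric] power2_eq_square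
        intro!: eucl_scale eucl_diff)
  \<comment> \<open>A point \<open>q\<close> within \<open>\<kappa>\<close> of \<open>b\<close>
    satisfies \<open>inner u (x - q) \<ge> \<delta> - \<kappa> = c * \<delta>\<close>, which is the
    slope asked for.\<close>
  define \<kappa> where "\<kappa> = (1 - c) * \<delta>"
  have \<kappa>: "0 < \<kappa>" using c \<delta> by (simp add: \<kappa>_def)
  let ?M' = "M - ball b \<kappa>"
  \<comment> \<open>Since \<open>b\<close> is the only nearest point of \<open>x\<close>,
    compactness leaves a gap between \<open>\<delta>\<close> and the distances to the rest of
    \<open>M\<close>.\<close>
  obtain s0 where s0: "s0 > 0" "\<And>q. q \<in> ?M' \<Longrightarrow> dist x q \<ge> \<delta> + 2 * s0"
  proof (cases "?M' = {}")
    case True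
    then show ?thesis using that[of 1] by (metis empty_iff zero_less_one)
  next
    case False
    have "compact ?M'"
      using M(1) by (simp add: compact_diff)
    then obtain q where q: "q \<in> ?M'" "infdist x ?M' = dist x q"
      using False compact_infdist_attained by metis
    have "q \<noteq> b" using q \<kappa> by auto
    then have "dist x q \<noteq> \<delta>"
      using nearest_unique[of x q b] q b x \<delta>_def by auto
    moreover have "\<delta> \<le> dist x q"
      using q by (auto simp: \<delta>_def intro: infdist_le)
    ultimately have "\<delta> < dist x q" by simp
    moreover have "dist x p \<ge> dist x q" if "p \<in> ?M'" for p
      using infdist_le[OF that, of x] q by simp
    ultimately show ?thesis
      by (intro that[of "(dist x q - \<delta>) / 2"]) (auto simp: field_simps)
  qed
  define s where "s = min (e / 2) (s0 / 2)"
  have s: "0 < s" "s < e" "s < s0"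
    using s0 e by (auto simp: s_def)
  define z where "z = x + s *\<^sub>R u"
  have zx: "dist z x = s"
    using s u by (simp add: z_def dist_norm)
  obtain q where q: "q \<in> M" "infdist z M = dist z q"
    using compact_infdist_attained[OF M(1,2)] by metis
  \<comment> \<open>A step of length \<open>s < s0\<close> raises the distance to \<open>M\<close>
    by at most \<open>s\<close>, which is too little to reach the points beyond the gap.\<close>
  have "q \<in> ball b \<kappa>"
  proof (rule ccontr)
    assume "q \<notin> ball b \<kappa>"
    then have "dist x q \<ge> \<delta> + 2 * s0"
      using q s0 by auto
    moreover have "infdist z M \<le> \<delta> + s"
      using infdist_triangle[of z M x] zx by (simp add: \<delta>_def)
    ultimately show False
      using q zx s dist_triangle[of x q z] by (simp add: dist_commute)
  qed
  then have "norm (b - q) \<le> \<kappa>"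
    by (simp add: dist_norm)
  then have "\<bar>inner u (b - q)\<bar> \<le> \<kappa>"
    using Cauchy_Schwarz_ineq2[of u "b - q"] u by simp
  moreover have "inner u (x - q) = \<delta> + inner u (b - q)"
    using u(2) by (simp add: inner_diff_right)
  ultimately have inn: "inner u (x - q) \<ge> c * \<delta>"
    by (simp add: \<kappa>_def algebra_simps)
  have "\<delta> \<le> norm (x - q)"
    using q infdist_le[of q M x] by (simp add: \<delta>_def dist_norm)
  then have d2: "\<delta>\<^sup>2 \<le> (norm (x - q))\<^sup>2"
    using \<delta> by (intro power_mono) auto
  have "(\<delta> + c * s)\<^sup>2 = \<delta>\<^sup>2 + 2 * s * (c * \<delta>) + c\<^sup>2 * s\<^sup>2"
    by (simp add: power2_eq_square algebra_simps)
  also have "\<dots> \<le> (norm (x - q))\<^sup>2 + 2 * s * inner u (x - q) + 1 * s\<^sup>2"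
    using d2 inn s c by (intro add_mono mult_left_mono mult_right_mono) (auto simp: power_le_one)
  also have "\<dots> = (norm (z - q))\<^sup>2"
    using norm_add_scaleR_power2[of "x - q" s u] u by (simp add: z_def algebra_simps)
  finally have "\<delta> + c * s \<le> norm (z - q)"
    by (rule power2_le_imp_le) simp
  then have "infdist z M \<ge> infdist x M + c * dist z x"
    using q zx by (simp add: \<delta>_def dist_norm)
  moreover have "z \<in> eucl D"
    unfolding z_def using x u by (intro eucl_add eucl_scale) auto
  ultimately show ?thesis
    using that zx s by force
qed

text \<open>Among the points of the ball that keep the average slope \<open>c\<close> from
  \<open>x\<close>, one maximises the distance to \<open>M\<close>. If it were not on the boundary
  sphere, \<open>infdist_slope\<close> would provide a better one.\<close>

lemma infdist_ascent:
  assumes x: "x \<in> eucl D" "0 < infdist x M" and h: "0 < h" "infdist x M + h < \<rho>" and c: "0 < c" "c < 1"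
  obtains y where "y \<in> eucl D" "dist y x \<le> h" "infdist y M \<ge> infdist x M + c * h"
proof -
  let ?S = "{y \<in> cball x h \<inter> eucl D. infdist x M + c * dist y x \<le> infdist y M}"
  have "compact ?S"
  proof -
    have "closed {y. infdist x M + c * dist y x \<le> infdist y M}"
      by (intro closed_Collect_le continuous_intros)
    then have "compact ((cball x h \<inter> eucl D) \<inter> {y. infdist x M + c * dist y x \<le> infdist y M})"
      using compact_cball_eucl by blast
    then show ?thesis
      by (rule back_subst[of compact]) auto
  qed
  moreover have "x \<in> ?S" using x h by auto
  moreover have "continuous_on ?S (\<lambda>y. infdist y M)"
    by (intro continuous_intros)
  ultimately obtain y where y: "y \<in> ?S" "\<And>z. z \<in> ?S \<Longrightarrow> infdist z M \<le> infdist y M"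
    using continuous_attains_sup[of ?S "\<lambda>y. infdist y M"] by blast
  have yx: "infdist x M \<le> infdist y M" "infdist y M \<le> infdist x M + h"
    using y(2)[OF \<open>x \<in> ?S\<close>] infdist_triangle[of y M x] y(1) by (auto simp: dist_commute)
  have "dist y x = h"
  proof (rule ccontr)
    assume "dist y x \<noteq> h"
    then have "0 < h - dist y x" using y by (auto simp: dist_commute)
    then obtain z where z: "z \<in> eucl D" "z \<noteq> y" "dist z y < h - dist y x"
        "infdist z M \<ge> infdist y M + c * dist z y"
      using infdist_slope[of y c "h - dist y x"] y yx x h c by auto
    have "c * dist z x \<le> c * (dist z y + dist y x)"
      using c dist_triangle by (intro mult_left_mono) auto
    then have "infdist x M + c * dist z x \<le> infdist z M"
      using z y by (simp add: algebra_simps)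
    moreover have "dist x z \<le> h"
      using z dist_triangle[of z x y] by (simp add: dist_commute)
    ultimately have "infdist z M \<le> infdist y M"
      using y(2) z by auto
    moreover have "0 < c * dist z y" using c z by simp
    ultimately show False using z by simp
  qed
  then show ?thesis using that y by auto
qed

text \<open>Within a ball of radius \<open>h\<close> about \<open>x\<close> the distance to
  \<open>M\<close> can grow by the full amount \<open>h\<close>. The point where it does must lie on
  the ray from \<open>b\<close> through \<open>x\<close>, so \<open>b\<close> stays nearest along
  this ray until the distance \<open>\<rho>\<close>.\<close>

lemma infdist_normal_extension:
  assumes x: "x \<in> eucl D" and b: "b \<in> M" "dist x b = infdist x M" "0 < infdist x M"
    and t: "infdist x M < t" "t < \<rho>"
  shows "infdist (b + (t / infdist x M) *\<^sub>R (x - b)) M = t"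
proof -
  define \<delta> where "\<delta> = infdist x M"
  define h where "h = t - \<delta>"
  have h: "0 < h" "\<delta> + h < \<rho>" "0 < \<delta>" using t b by (auto simp: h_def \<delta>_def)
  let ?S = "cball x h \<inter> eucl D"
  have "x \<in> ?S" using x h by auto
  moreover have "continuous_on ?S (\<lambda>y. infdist y M)"
    by (intro continuous_intros)
  ultimately obtain y where y: "y \<in> ?S" "\<And>z. z \<in> ?S \<Longrightarrow> infdist z M \<le> infdist y M"
    using continuous_attains_sup[of ?S "\<lambda>y. infdist y M"] compact_cball_eucl by blast
  \<comment> \<open>Every slope below 1 is available, and the maximiser \<open>y\<close> serves all
    of them, so that \<open>c\<close> may tend to 1.\<close>
  have "\<delta> + c * h \<le> infdist y M" if c: "0 < c" "c < 1" for c
  proof -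
    obtain z where "z \<in> eucl D" "dist z x \<le> h" "infdist z M \<ge> infdist x M + c * h"
      using infdist_ascent[of x h c] x b h c by (auto simp: \<delta>_def)
    then show ?thesis
      using y(2)[of z] by (auto simp: \<delta>_def dist_commute)
  qed
  then have "\<forall>c\<in>{0<..<1}. c \<le> (infdist y M - \<delta>) / h"
    using h by (auto simp: field_simps)
  then have "1 \<le> (infdist y M - \<delta>) / h"
    by (metis dense_le_bounded greaterThanLessThan_iff zero_less_one)
  then have "t \<le> infdist y M"
    using h by (simp add: h_def field_simps)
  moreover have yb: "infdist y M \<le> dist y b"
    using b by (intro infdist_le)
  moreover have xb: "norm (x - b) = \<delta>" using b by (simp add: \<delta>_def dist_norm)
  moreover have yx: "norm (y - x) \<le> h" using y by (simp add: dist_norm norm_minus_commute)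
  moreover have "norm (y - b) \<le> norm (y - x) + norm (x - b)"
    using norm_triangle_ineq[of "y - x" "x - b"] by simp
  ultimately have eq: "norm (y - b) = t" "norm (y - x) = h" "infdist y M = t"
    by (auto simp: h_def dist_norm)
  \<comment> \<open>Equality in the triangle inequality makes \<open>y - x\<close> a nonnegative
    multiple of \<open>x - b\<close>.\<close>
  then have "norm ((y - x) + (x - b)) = norm (y - x) + norm (x - b)"
    using xb by (simp add: h_def)
  then have "norm (y - x) *\<^sub>R (x - b) = norm (x - b) *\<^sub>R (y - x)"
    by (rule norm_triangle_eq[THEN iffD1])
  then have "\<delta> *\<^sub>R (y - x) = h *\<^sub>R (x - b)" using eq xb by simp
  then have "(1 / \<delta>) *\<^sub>R (\<delta> *\<^sub>R (y - x)) = (1 / \<delta>) *\<^sub>R (h *\<^sub>R (x - b))" by simp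
  then have "y = x + (h / \<delta>) *\<^sub>R (x - b)"
    using h(3) by (simp add: algebra_simps)
  also have "\<dots> = b + (1 + h / \<delta>) *\<^sub>R (x - b)"
    by (simp add: algebra_simps)
  also have "1 + h / \<delta> = t / \<delta>"
    using h by (simp add: h_def field_simps)
  finally show ?thesis
    using eq by (simp add: \<delta>_def)
qed

text \<open>A normal vector need not be proximal a priori.  Nearest points of \<open>a + t v\<close> lie at distance
  \<open>o(t)\<close> from \<open>a\<close>, so the proximal normals at these points converge to \<open>v\<close>.\<close>

lemma normal_ball_empty:
  assumes a: "a \<in> M" and v: "v \<in> eucl D" "norm v = 1" and s: "0 < s" "s < \<rho>" and c: "c \<in> M"
    and approx: "\<And>e. 0 < e \<Longrightarrow> \<exists>r>0. \<forall>b\<in>M. dist b a < r \<longrightarrow> inner (b - a) v \<le> e * norm (b - a)"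
  shows "s \<le> dist (a + s *\<^sub>R v) c"
proof -
  \<comment> \<open>For a fixed accuracy \<open>e\<close>, the centre \<open>a + s v\<close> is
    compared with the centre of a ball of radius \<open>s\<close> known to avoid \<open>M\<close>.
    Two errors of at most \<open>4 * e * s\<close> each are rounded up to
    \<open>10 * e * s\<close>.\<close>
  have key: "s - 10 * e * s \<le> dist (a + s *\<^sub>R v) c" if e: "0 < e" "e \<le> 1/4" for e
  proof -
    obtain r where r: "r > 0" "\<And>b. b \<in> M \<Longrightarrow> dist b a < r \<Longrightarrow> inner (b - a) v \<le> e * norm (b - a)"
      using approx[OF e(1)] by blast
    \<comment> \<open>A nearest point of \<open>a + t v\<close> lies within \<open>2 * t\<close> of
      \<open>a\<close>, so \<open>r / 3\<close> keeps it in the range of the first-order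
      estimate.\<close>
    define t where "t = min (r / 3) (s / 2)"
    have t: "0 < t" "2 * t < r" "t < s" using r s by (auto simp: t_def)
    define x where "x = a + t *\<^sub>R v"
    have xE: "x \<in> eucl D"
      unfolding x_def using a M(3) v by (intro eucl_add eucl_scale) auto
    obtain b where b: "b \<in> M" "infdist x M = dist x b"
      using compact_infdist_attained[OF M(1,2)] by metis
    define \<tau> where "\<tau> = dist x b"
    have xa: "dist x a = t" using v t by (simp add: x_def dist_norm)
    have "\<tau> \<le> t"
      using infdist_le[OF a, of x] b xa by (simp add: \<tau>_def)
    then have "dist b a \<le> 2 * t"
      using dist_triangle[of b a x] xa by (simp add: \<tau>_def dist_commute)
    then have ba: "inner (b - a) v \<le> e * norm (b - a)"
      using r(2) b t by simp
    have "\<tau>\<^sup>2 = (norm ((b - a) + (- t) *\<^sub>R v))\<^sup>2"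
      by (simp add: \<tau>_def dist_norm x_def norm_minus_commute algebra_simps)
    also have "\<dots> = (norm (b - a))\<^sup>2 - 2 * t * inner (b - a) v + t\<^sup>2"
      using norm_add_scaleR_power2[of "b - a" "-t" v] v by (simp add: inner_commute)
    finally have "(norm (b - a))\<^sup>2 \<le> 2 * t * inner (b - a) v"
      using \<open>\<tau> \<le> t\<close> power_mono[of \<tau> t 2] by (simp add: \<tau>_def)
    also have "\<dots> \<le> 2 * t * (e * norm (b - a))"
      using ba t by (intro mult_left_mono) auto
    finally have nba: "norm (b - a) \<le> 2 * t * e"
      by (cases "b = a") (use t e in \<open>auto simp: power2_eq_square\<close>)
    have "t \<le> \<tau> + norm (b - a)"
      using dist_triangle[of x a b] xa by (simp add: \<tau>_def dist_norm)
    then have \<tau>: "t * (1 - 2 * e) \<le> \<tau>" using nba by (simp add: algebra_simps)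
    moreover have "0 < t * (1 - 2 * e)" using t e by simp
    ultimately have \<tau>0: "0 < \<tau>" by simp
    \<comment> \<open>The segment from \<open>b\<close> through \<open>x\<close> is prolonged to
      length \<open>s\<close>. By \<open>infdist_normal_extension\<close> the open ball of radius
      \<open>s\<close> about \<open>y\<close> misses \<open>M\<close>.\<close>
    define y where "y = b + (s / \<tau>) *\<^sub>R (x - b)"
    have "infdist y M = s"
      using infdist_normal_extension[OF xE b(1) b(2)[symmetric], of s] b \<tau>0 \<open>\<tau> \<le> t\<close> t s
      by (simp add: y_def \<tau>_def)
    then have "s \<le> dist y c" using infdist_le[OF c, of y] by simp
    have "y - (a + s *\<^sub>R v) = (1 - s / \<tau>) *\<^sub>R (b - a) + (s * (t / \<tau> - 1)) *\<^sub>R v"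
      by (simp add: y_def x_def algebra_simps)
    then have "norm (y - (a + s *\<^sub>R v)) \<le> \<bar>1 - s / \<tau>\<bar> * norm (b - a) + \<bar>s * (t / \<tau> - 1)\<bar>"
      using norm_triangle_ineq[of "(1 - s / \<tau>) *\<^sub>R (b - a)" "(s * (t / \<tau> - 1)) *\<^sub>R v"] v by simp
    moreover have "\<bar>1 - s / \<tau>\<bar> * norm (b - a) \<le> (s / \<tau>) * (2 * t * e)"
    proof (rule mult_mono)
      show "\<bar>1 - s / \<tau>\<bar> \<le> s / \<tau>"
        using \<tau>0 \<open>\<tau> \<le> t\<close> t by (simp add: field_simps abs_le_iff)
    qed (use nba \<tau>0 s in auto)
    moreover have "t / \<tau> \<le> 1 + 4 * e"
    proof -
      have "t * 1 \<le> t * ((1 - 2 * e) * (1 + 4 * e))"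
      proof (rule mult_left_mono)
        have "0 \<le> e * (2 - 8 * e)" using e by simp
        then show "1 \<le> (1 - 2 * e) * (1 + 4 * e)" by (simp add: algebra_simps)
      qed (use t in simp)
      also have "\<dots> \<le> \<tau> * (1 + 4 * e)"
        using mult_right_mono[OF \<tau>, of "1 + 4 * e"] e by (simp add: mult.assoc)
      finally show ?thesis using \<tau>0 by (simp add: field_simps)
    qed
    moreover have "\<bar>s * (t / \<tau> - 1)\<bar> = s * (t / \<tau> - 1)"
      using s \<tau>0 \<open>\<tau> \<le> t\<close> by (simp add: field_simps)
    moreover have "s * (t / \<tau> - 1) \<le> s * (4 * e)"
      using \<open>t / \<tau> \<le> 1 + 4 * e\<close> s by (intro mult_left_mono) auto
    moreover have "(s / \<tau>) * (2 * t * e) \<le> s * 2 * e * 2"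
    proof -
      have "(s / \<tau>) * (2 * t * e) = (s * 2 * e) * (t / \<tau>)" by simp
      also have "\<dots> \<le> (s * 2 * e) * 2"
        using \<open>t / \<tau> \<le> 1 + 4 * e\<close> s e by (intro mult_left_mono) auto
      finally show ?thesis by simp
    qed
    ultimately have "norm (y - (a + s *\<^sub>R v)) \<le> 10 * e * s"
      using e s by (simp add: algebra_simps)
    then show ?thesis
      using \<open>s \<le> dist y c\<close> dist_triangle[of y c "a + s *\<^sub>R v"] by (simp add: dist_norm)
  qed
  show ?thesis
  proof (rule field_le_epsilon)
    fix e :: real assume e: "0 < e"
    define e' where "e' = min (1/4) (e / (10 * s))"
    have "0 < e'" "e' \<le> 1/4" "10 * e' * s \<le> e"
      using e s by (auto simp: e'_def field_simps min_def)
    then show "s \<le> dist (a + s *\<^sub>R v) c + e"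
      using key[of e'] by linarith
  qed
qed

text \<open>This and \<open>tangent_estimate_imp_reach\<close> are the two halves of Theorem 4.18 in Federer's
  \<open>Curvature measures\<close>.\<close>

lemma reach_imp_tangent_estimate:
  assumes a: "a \<in> M" and b: "b \<in> M" and T: "subspace T" "T \<subseteq> eucl D" and "0 < \<rho>"
    and approx: "\<And>e. 0 < e \<Longrightarrow> \<exists>r>0. \<forall>b\<in>M. dist b a < r \<longrightarrow>
      (\<exists>u\<in>T. norm (b - a - u) \<le> e * norm (b - a))"
  shows "\<exists>t\<in>T. norm (b - a - t) \<le> (norm (b - a))\<^sup>2 / (2 * \<rho>)"
proof -
  define t where "t = orth_proj T (b - a)"
  define n where "n = b - a - t"
  have t: "t \<in> T" and n: "\<And>u. u \<in> T \<Longrightarrow> inner n u = 0"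
    using orth_proj_in[OF T(2,1)] inner_orth_proj[OF T(2,1)] by (auto simp: t_def n_def)
  have "norm n \<le> (norm (b - a))\<^sup>2 / (2 * \<rho>)"
  proof (cases "n = 0")
    case False
    define v where "v = n /\<^sub>R norm n"
    have v: "norm v = 1" using False by (simp add: v_def)
    have "v \<in> eucl D"
      unfolding v_def n_def using a b M(3) t T by (intro eucl_scale eucl_diff) auto
    have vT: "inner u v = 0" if "u \<in> T" for u
      using n[OF that] by (simp add: v_def inner_commute)
    have ap: "\<exists>r>0. \<forall>b\<in>M. dist b a < r \<longrightarrow> inner (b - a) v \<le> e * norm (b - a)" if "0 < e" for e
    proof -
      have "inner (b - a) v \<le> e * norm (b - a)" if "u \<in> T" "norm (b - a - u) \<le> e * norm (b - a)" for b u
      proof -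
        have "inner (b - a) v = inner (b - a - u) v"
          using vT[OF that(1)] by (simp add: inner_diff_left)
        also have "\<dots> \<le> norm (b - a - u)"
          using norm_cauchy_schwarz[of "b - a - u" v] v by simp
        finally show ?thesis using that by simp
      qed
      then show ?thesis using approx[OF \<open>0 < e\<close>] by meson
    qed
    have "inner (b - a) v = norm n"
    proof -
      have "inner (b - a) v = inner n v + inner t v"
        by (simp add: n_def inner_diff_left)
      then show ?thesis
        using vT[OF t] False
        by (simp add: v_def power2_norm_eq_inner[symmetric] power2_eq_square)
    qed
    \<comment> \<open>The ball of radius \<open>s\<close> touching \<open>M\<close> at
      \<open>a\<close> in direction \<open>v\<close> does not contain \<open>b\<close> in its
      interior. Expanding the square gives the bound, and afterwards \<open>s\<close> tends to
      \<open>\<rho>\<close>.\<close>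
    have le: "2 * norm n * s \<le> (norm (b - a))\<^sup>2" if s: "0 < s" "s < \<rho>" for s
    proof -
      have "s \<le> dist (a + s *\<^sub>R v) b"
        by (rule normal_ball_empty[OF a \<open>v \<in> eucl D\<close> v s b ap])
      then have "s \<le> norm ((b - a) + (- s) *\<^sub>R v)"
        by (simp add: dist_norm norm_minus_commute algebra_simps)
      then have "s\<^sup>2 \<le> (norm ((b - a) + (- s) *\<^sub>R v))\<^sup>2"
        using s by (intro power_mono) auto
      then show ?thesis
        using norm_add_scaleR_power2[of "b - a" "-s" v] v \<open>inner (b - a) v = norm n\<close>
        by (simp add: inner_commute mult.commute mult.left_commute)
    qed
    then have "s \<le> (norm (b - a))\<^sup>2 / (2 * norm n)" if "0 < s" "s < \<rho>" for s
      using that False by (simp add: field_simps)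
    then have "\<rho> \<le> (norm (b - a))\<^sup>2 / (2 * norm n)"
      using \<open>0 < \<rho>\<close> by (meson dense_le_bounded)
    then show ?thesis
      using False \<open>0 < \<rho>\<close> by (simp add: field_simps)
  qed (use \<open>0 < \<rho>\<close> in simp)
  then show ?thesis
    using t n_def by blast
qed

end

lemma tangent_estimate_imp_reach:
  assumes M: "compact M" "M \<noteq> {}" and "0 < \<rho>"
    and est: "\<And>a b. a \<in> M \<Longrightarrow> b \<in> M \<Longrightarrow>
      \<exists>t\<in>tangent_space M a. norm (b - a - t) \<le> (norm (b - a))\<^sup>2 / (2 * \<rho>)"
  shows "ereal \<rho> \<le> reach D M"
proof -
  have "\<rho> \<le> dist p x" if p: "p \<in> M" and x: "x \<in> med D M" for p x
  proof -
    obtain a b where ab: "a \<in> M" "b \<in> M" "a \<noteq> b" "norm (x - a) = infdist x M" "norm (x - b) = infdist x M"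
      using x M by (auto simp: med_def edist_eq_infdist)
    \<comment> \<open>Along a curve in \<open>M\<close> through \<open>a\<close> the squared
      distance to \<open>x\<close> has a minimum at \<open>a\<close>, so its derivative vanishes
      there.\<close>
    have perp: "inner (x - a) v = 0" if v: "v \<in> tangent_space M a" for v
    proof -
      obtain \<gamma> \<delta> where \<gamma>: "\<delta> > 0" "\<gamma> ` {-\<delta><..<\<delta>} \<subseteq> M" "\<gamma> 0 = a"
          "(\<gamma> has_vector_derivative v) (at (0::real))"
        using v by (auto simp: tangent_space_def)
      define f where "f s = inner (x - \<gamma> s) (x - \<gamma> s)" for s
      have "(f has_real_derivative - 2 * inner (x - a) v) (at 0)"
        using \<gamma>(4) unfolding f_def has_vector_derivative_def has_field_derivative_def
        by (auto intro!: derivative_eq_intros simp: \<gamma>(3) inner_commute fun_eq_iff algebra_simps)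
      moreover have "f 0 \<le> f s" if "\<bar>0 - s\<bar> < \<delta>" for s
      proof -
        have "s \<in> {-\<delta><..<\<delta>}" using that by auto
        then have "\<gamma> s \<in> M" using \<gamma>(2) by blast
        then have "infdist x M \<le> norm (x - \<gamma> s)"
          using infdist_le[of "\<gamma> s" M x] by (simp add: dist_norm)
        then have "(norm (x - a))\<^sup>2 \<le> (norm (x - \<gamma> s))\<^sup>2"
          using ab infdist_nonneg[of x M] by (intro power_mono) auto
        then show ?thesis
          by (simp add: f_def \<gamma>(3) power2_norm_eq_inner)
      qed
      ultimately have "- 2 * inner (x - a) v = 0"
        using DERIV_local_min[of f _ 0 \<delta>] \<gamma>(1) by blast
      then show ?thesis by simp
    qed
    obtain t where t: "t \<in> tangent_space M a" "norm (b - a - t) \<le> (norm (b - a))\<^sup>2 / (2 * \<rho>)"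
      using est ab by blast
    have "(norm (x - b))\<^sup>2 = (norm ((x - a) + (-1) *\<^sub>R (b - a)))\<^sup>2"
      by (simp add: algebra_simps)
    \<comment> \<open>This is the equality of the distances from \<open>x\<close> to
      \<open>a\<close> and \<open>b\<close>. Since \<open>x - a\<close> is normal, only the part of
      \<open>b - a\<close> off the tangent space contributes to the product, and that part is
      quadratically small.\<close>
    then have "(norm (b - a))\<^sup>2 = 2 * inner (x - a) (b - a)"
      using norm_add_scaleR_power2[of "x - a" "-1" "b - a"] ab by (simp add: inner_commute)
    also have "\<dots> = 2 * inner (x - a) (b - a - t)"
      using perp[OF t(1)] by (simp add: inner_diff_right)
    also have "\<dots> \<le> 2 * (norm (x - a) * norm (b - a - t))"
      using norm_cauchy_schwarz by (intro mult_left_mono) auto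
    also have "\<dots> \<le> 2 * (norm (x - a) * ((norm (b - a))\<^sup>2 / (2 * \<rho>)))"
      using t by (intro mult_left_mono) auto
    finally have "\<rho> \<le> norm (x - a)"
      using ab(3) \<open>0 < \<rho>\<close> by (simp add: field_simps)
    then show ?thesis
      using infdist_le[OF p, of x] ab by (simp add: dist_commute)
  qed
  then show ?thesis
    unfolding reach_def edist_def by (intro INF_greatest) auto
qed

section \<open>Tangent spaces of submanifolds\<close>

text \<open>The constant is the minimum of \<open>norm (f h)\<close> over the compact unit sphere of
  \<open>eucl d\<close>. If the sphere is empty, only \<open>h = 0\<close> has to be considered and
  any constant works.\<close>

lemma inj_on_eucl_lower_bound:
  assumes f: "bounded_linear f" "inj_on f (eucl d)"
  obtains m where "0 < m" "\<And>h. h \<in> eucl d \<Longrightarrow> m * norm h \<le> norm (f h)"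
proof -
  interpret f: bounded_linear f by fact
  let ?S = "sphere 0 1 \<inter> eucl d"
  have "compact ?S"
  proof -
    have "compact ((cball 0 1 \<inter> eucl d) \<inter> sphere (0::fseq) 1)"
      unfolding sphere_def
      by (rule compact_Int_closed[OF compact_cball_eucl]) (intro closed_Collect_eq continuous_intros)
    moreover have "(cball 0 1 \<inter> eucl d) \<inter> sphere 0 1 = ?S" by auto
    ultimately show ?thesis by simp
  qed
  show ?thesis
  proof (cases "?S = {}")
    case True
    have "h = 0" if "h \<in> eucl d" for h
    proof (rule ccontr)
      assume "h \<noteq> 0"
      then have "h /\<^sub>R norm h \<in> ?S" using that by (auto intro: eucl_scale)
      then show False using True by blast
    qed
    then show ?thesis using that[of 1] f.zero by force
  next
    case False
    have "continuous_on ?S (\<lambda>h. norm (f h))"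
      by (intro continuous_intros f.continuous_on)
    then obtain g where g: "g \<in> ?S" "\<And>h. h \<in> ?S \<Longrightarrow> norm (f g) \<le> norm (f h)"
      using continuous_attains_inf[OF \<open>compact ?S\<close> False] by blast
    show ?thesis
    proof (rule that[of "norm (f g)"])
      have "f g \<noteq> f 0"
        using inj_onD[OF f(2), of g 0] g by auto
      then show "0 < norm (f g)" by (simp add: f.zero)
      fix h assume h: "h \<in> eucl d"
      show "norm (f g) * norm h \<le> norm (f h)"
      proof (cases "h = 0")
        case False
        then have "h /\<^sub>R norm h \<in> ?S" using h by (auto intro: eucl_scale)
        then have "norm (f g) \<le> norm (f (h /\<^sub>R norm h))" by (rule g)
        then show ?thesis using False by (simp add: f.scaleR field_simps)
      qed simp
    qed
  qed
qed

context
  fixes d :: nat and M W U :: "fseq set" and \<phi> \<psi> :: "fseq \<Rightarrow> fseq"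
    and \<phi>' :: "fseq \<Rightarrow> fseq \<Rightarrow>\<^sub>L fseq" and w :: fseq
  assumes W: "openin (top_of_set (eucl d)) W" and U: "openin (top_of_set M) U"
    and hom: "homeomorphism W U \<phi> \<psi>"
    and cont: "continuous_on W \<phi>'"
    and deriv: "\<And>w. w \<in> W \<Longrightarrow> (\<phi> has_derivative blinfun_apply (\<phi>' w)) (at w within W)"
    and inj: "\<And>w. w \<in> W \<Longrightarrow> inj_on (blinfun_apply (\<phi>' w)) (eucl d)"
    and w: "w \<in> W"
begin

text \<open>The first-order expansion of \<open>\<phi>\<close> has an error relative to the
  parameter distance. Injectivity of the derivative converts it into an error relative to the
  distance in \<open>M\<close>, and continuity of \<open>\<psi>\<close> brings nearby points of
  \<open>M\<close> into its range.\<close>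

lemma chart_tangent_approx:
  assumes e: "0 < e"
  shows "\<exists>r>0. \<forall>b\<in>M. dist b (\<phi> w) < r \<longrightarrow>
    (\<exists>u\<in>blinfun_apply (\<phi>' w) ` eucl d. norm (b - \<phi> w - u) \<le> e * norm (b - \<phi> w))"
proof -
  obtain m where m: "0 < m" "\<And>h. h \<in> eucl d \<Longrightarrow> m * norm h \<le> norm (\<phi>' w h)"
    using inj_on_eucl_lower_bound[OF blinfun.bounded_linear_right inj[OF w]] by metis
  have WE: "W \<subseteq> eucl d" using W openin_imp_subset by blast
  have hm: "\<phi> ` W = U" "\<psi> ` U = W" "\<And>x. x \<in> W \<Longrightarrow> \<psi> (\<phi> x) = x" "\<And>y. y \<in> U \<Longrightarrow> \<phi> (\<psi> y) = y"
      "continuous_on U \<psi>"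
    using hom by (auto simp: homeomorphism_def)
  \<comment> \<open>The bound \<open>m / 2\<close> lets the error be absorbed, giving
    \<open>norm (y - w) \<le> 2 / m * norm (b - \<phi> w)\<close>. The bound
    \<open>e * m / 2\<close> then produces the factor \<open>e\<close>.\<close>
  define e' where "e' = min (m / 2) (e * m / 2)"
  have e': "0 < e'" "e' \<le> m / 2" "e' \<le> e * m / 2" using m e by (auto simp: e'_def)
  obtain r1 where r1: "r1 > 0" "\<And>y. y \<in> W \<Longrightarrow> norm (y - w) < r1 \<Longrightarrow>
      norm (\<phi> y - \<phi> w - \<phi>' w (y - w)) \<le> e' * norm (y - w)"
    using deriv[OF w] e'(1) unfolding has_derivative_within_alt by blast
  have "\<phi> w \<in> U" using hm w by blast
  then obtain r2 where r2: "r2 > 0" "\<And>y. y \<in> U \<Longrightarrow> dist y (\<phi> w) < r2 \<Longrightarrow> dist (\<psi> y) (\<psi> (\<phi> w)) < r1"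
    using hm(5) r1(1) unfolding continuous_on_iff by meson
  obtain r3 where r3: "r3 > 0" "\<And>y. y \<in> M \<Longrightarrow> dist y (\<phi> w) < r3 \<Longrightarrow> y \<in> U"
    using U \<open>\<phi> w \<in> U\<close> unfolding openin_euclidean_subtopology_iff by meson
  show ?thesis
  proof (intro exI[of _ "min r2 r3"] conjI ballI impI)
    show "0 < min r2 r3" using r2 r3 by simp
    fix b assume b: "b \<in> M" "dist b (\<phi> w) < min r2 r3"
    then have "b \<in> U" using r3 by simp
    define y where "y = \<psi> b"
    have y: "y \<in> W" "\<phi> y = b" "norm (y - w) < r1"
      using hm \<open>b \<in> U\<close> r2(2)[of b] b w by (auto simp: y_def dist_norm)
    have err: "norm (b - \<phi> w - \<phi>' w (y - w)) \<le> e' * norm (y - w)"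
      using r1(2)[OF y(1,3)] y by simp
    have yw: "y - w \<in> eucl d" using y w WE by (auto intro: eucl_diff)
    have "m * norm (y - w) \<le> norm (\<phi>' w (y - w))" using m yw by blast
    also have "\<dots> \<le> norm (b - \<phi> w) + norm (b - \<phi> w - \<phi>' w (y - w))"
      using norm_triangle_ineq4[of "b - \<phi> w" "b - \<phi> w - \<phi>' w (y - w)"] by simp
    also have "\<dots> \<le> norm (b - \<phi> w) + m / 2 * norm (y - w)"
      using err e' mult_right_mono[OF e'(2) norm_ge_zero[of "y - w"]] by simp
    finally have "norm (y - w) \<le> 2 / m * norm (b - \<phi> w)"
      using m by (simp add: field_simps)
    then have "e' * norm (y - w) \<le> (e * m / 2) * (2 / m * norm (b - \<phi> w))"
      using e' m by (intro mult_mono) auto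
    then have "norm (b - \<phi> w - \<phi>' w (y - w)) \<le> e * norm (b - \<phi> w)"
      using err m by simp
    then show "\<exists>u\<in>blinfun_apply (\<phi>' w) ` eucl d. norm (b - \<phi> w - u) \<le> e * norm (b - \<phi> w)"
      using yw by blast
  qed
qed

text \<open>Straight lines in the chart realise every vector of the image as a velocity. Conversely,
  the component of a velocity normal to the image vanishes by
  \<open>chart_tangent_approx\<close>.\<close>

lemma chart_tangent_space: "tangent_space M (\<phi> w) = blinfun_apply (\<phi>' w) ` eucl d"
proof
  have WE: "W \<subseteq> eucl d" using W openin_imp_subset by blast
  show "blinfun_apply (\<phi>' w) ` eucl d \<subseteq> tangent_space M (\<phi> w)"
  proof
    fix v assume "v \<in> blinfun_apply (\<phi>' w) ` eucl d"
    then obtain h where h: "h \<in> eucl d" "v = \<phi>' w h" by blast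
    obtain r where r: "r > 0" "\<And>y. y \<in> eucl d \<Longrightarrow> dist y w < r \<Longrightarrow> y \<in> W"
      using W w unfolding openin_euclidean_subtopology_iff by meson
    \<comment> \<open>The summand 1 keeps the quotient positive for \<open>h = 0\<close>.\<close>
    define \<delta> where "\<delta> = r / (norm h + 1)"
    have pos: "0 < norm h + 1" by (simp add: add_nonneg_pos)
    have \<delta>: "\<delta> > 0" using r pos by (simp add: \<delta>_def)
    define l where "l t = w + t *\<^sub>R h" for t
    have lW: "l t \<in> W" if "t \<in> {-\<delta><..<\<delta>}" for t
    proof (rule r(2))
      show "l t \<in> eucl d" using w WE h by (auto simp: l_def intro!: eucl_add eucl_scale)
      have "\<bar>t\<bar> * norm h \<le> \<bar>t\<bar> * (norm h + 1)" by (intro mult_left_mono) auto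
      also have "\<dots> < \<delta> * (norm h + 1)"
        using that pos by (intro mult_strict_right_mono) auto
      also have "\<dots> = r" using pos by (simp add: \<delta>_def)
      finally show "dist (l t) w < r" by (simp add: l_def dist_norm)
    qed
    have vd: "((\<phi> \<circ> l) has_vector_derivative \<phi>' (l t) h) (at t)" if t: "t \<in> {-\<delta><..<\<delta>}" for t
    proof -
      have 1: "(l has_derivative (\<lambda>s. s *\<^sub>R h)) (at t within {-\<delta><..<\<delta>})"
        unfolding l_def by (auto intro!: derivative_eq_intros)
      have 2: "(\<phi> has_derivative \<phi>' (l t)) (at (l t) within l ` {-\<delta><..<\<delta>})"
        by (rule has_derivative_subset[OF deriv[OF lW[OF t]]]) (use lW in auto)
      have "((\<phi> \<circ> l) has_derivative (\<phi>' (l t) \<circ> (\<lambda>s. s *\<^sub>R h))) (at t within {-\<delta><..<\<delta>})"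
        by (rule diff_chain_within[OF 1 2])
      then show ?thesis
        using t by (simp add: has_vector_derivative_def o_def blinfun.scaleR_right
            at_within_open[OF _ open_greaterThanLessThan])
    qed
    have "(\<phi> \<circ> l) C1_differentiable_on {-\<delta><..<\<delta>}"
      unfolding C1_differentiable_on_def
    proof (intro exI conjI ballI)
      show "continuous_on {-\<delta><..<\<delta>} (\<lambda>t. \<phi>' (l t) h)"
        by (intro continuous_intros continuous_on_compose2[OF cont]) (auto simp: lW, auto simp: l_def intro!: continuous_intros)
    qed (rule vd)
    moreover have "(\<phi> \<circ> l) ` {-\<delta><..<\<delta>} \<subseteq> M"
      using lW U hom openin_imp_subset by (fastforce simp: homeomorphism_def)
    moreover have "(\<phi> \<circ> l) 0 = \<phi> w" "((\<phi> \<circ> l) has_vector_derivative v) (at 0)"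
      using vd[of 0] \<delta> h by (auto simp: l_def)
    ultimately show "v \<in> tangent_space M (\<phi> w)"
      unfolding tangent_space_def using \<delta> by blast
  qed
  show "tangent_space M (\<phi> w) \<subseteq> blinfun_apply (\<phi>' w) ` eucl d" (is "_ \<subseteq> ?R")
  proof
    fix v assume "v \<in> tangent_space M (\<phi> w)"
    then obtain \<gamma> \<delta> where \<gamma>: "\<delta> > 0" "\<gamma> ` {-\<delta><..<\<delta>} \<subseteq> M" "\<gamma> 0 = \<phi> w"
        "(\<gamma> has_vector_derivative v) (at (0::real))"
      by (auto simp: tangent_space_def)
    have "?R = span (blinfun_apply (\<phi>' w) ` axis_fseq ` {..<d})"
      using linear_span_image[OF bounded_linear.linear[OF blinfun.bounded_linear_right],
          of "\<phi>' w" "axis_fseq ` {..<d}"]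
      by (simp add: span_axis_fseq)
    then have "orth_decomp ?R" using orth_decomp_span[of "blinfun_apply (\<phi>' w) ` axis_fseq ` {..<d}"] by simp
    then obtain y where y: "y \<in> ?R" "\<And>u. u \<in> ?R \<Longrightarrow> inner (v - y) u = 0"
      unfolding orth_decomp_def by meson
    define n where "n = v - y"
    have nu: "inner n u = 0" if "u \<in> ?R" for u using y(2)[OF that] by (simp add: n_def)
    \<comment> \<open>A short piece of the curve is approximated by \<open>t v\<close> and by a
      vector \<open>u\<close> of the image, both up to order \<open>e * t\<close>. As
      \<open>n\<close> is orthogonal to \<open>u\<close>, pairing with \<open>n\<close> bounds
      \<open>t\<close> times the square of \<open>norm n\<close>.\<close>
    have bound: "norm n \<le> e * (norm v + 2)" if e: "0 < e" "e < 1" for e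
    proof (cases "n = 0")
      case False
      obtain r where r: "r > 0" "\<And>b. b \<in> M \<Longrightarrow> dist b (\<phi> w) < r \<Longrightarrow>
          \<exists>u\<in>?R. norm (b - \<phi> w - u) \<le> e * norm (b - \<phi> w)"
        using chart_tangent_approx[OF e(1)] by blast
      obtain r1 where r1: "r1 > 0" "\<And>t. \<bar>t\<bar> < r1 \<Longrightarrow> norm (\<gamma> t - \<gamma> 0 - t *\<^sub>R v) \<le> e * \<bar>t\<bar>"
        using \<gamma>(4) e unfolding has_vector_derivative_def has_derivative_at_alt by (metis diff_zero real_norm_def)
      define t where "t = min (min (\<delta> / 2) (r1 / 2)) (r / (2 * (norm v + 1)))"
      have pos: "0 < norm v + 1" by (simp add: add_nonneg_pos)
      have t: "0 < t" "t < \<delta>" "t < r1" "t * (norm v + 1) < r"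
      proof -
        show "0 < t" "t < \<delta>" "t < r1" using \<gamma>(1) r1 r pos by (auto simp: t_def)
        have "t \<le> r / (2 * (norm v + 1))" by (simp add: t_def)
        then have "t * (norm v + 1) \<le> r / 2" using pos by (simp add: field_simps)
        then show "t * (norm v + 1) < r" using r by simp
      qed
      define b where "b = \<gamma> t"
      have err: "norm (b - \<phi> w - t *\<^sub>R v) \<le> e * t"
        using r1(2)[of t] t \<gamma>(3) by (simp add: b_def)
      have nb: "norm (b - \<phi> w) \<le> t * (norm v + e)"
        using err norm_triangle_sub[of "b - \<phi> w" "t *\<^sub>R v"] t by (simp add: algebra_simps)
      also have "\<dots> \<le> t * (norm v + 1)"
        using e t by (intro mult_left_mono) auto
      finally have nb1: "norm (b - \<phi> w) \<le> t * (norm v + 1)" .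
      have "b \<in> M" using \<gamma>(2) t by (auto simp: b_def)
      then obtain u where u: "u \<in> ?R" "norm (b - \<phi> w - u) \<le> e * norm (b - \<phi> w)"
        using r(2)[of b] nb1 t by (auto simp: dist_norm)
      have "inner n v = inner n n" using nu[OF y(1)] by (simp add: n_def inner_diff_right)
      then have "t * (norm n)\<^sup>2 = inner n (t *\<^sub>R v)"
        by (simp add: power2_norm_eq_inner)
      also have "\<dots> = inner n (b - \<phi> w - u) - inner n (b - \<phi> w - t *\<^sub>R v)"
        using nu[OF u(1)] by (simp add: inner_diff_right)
      also have "\<dots> \<le> norm n * norm (b - \<phi> w - u) + norm n * norm (b - \<phi> w - t *\<^sub>R v)"
        using Cauchy_Schwarz_ineq2[of n "b - \<phi> w - u"] Cauchy_Schwarz_ineq2[of n "b - \<phi> w - t *\<^sub>R v"]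
        by linarith
      also have "\<dots> \<le> norm n * (e * (t * (norm v + 1))) + norm n * (e * t)"
      proof -
        have "e * norm (b - \<phi> w) \<le> e * (t * (norm v + 1))" using nb1 e by (intro mult_left_mono) auto
        then show ?thesis using u(2) err by (intro add_mono mult_left_mono) auto
      qed
      also have "\<dots> = t * norm n * (e * (norm v + 2))" by (simp add: algebra_simps)
      finally show ?thesis
        using t False by (simp add: power2_eq_square)
    qed (use e in simp)
    have "norm n \<le> 0"
    proof (rule field_le_epsilon)
      fix c :: real assume c: "0 < c"
      have pos: "0 < norm v + 2" by (simp add: add_nonneg_pos)
      define e where "e = min (1/2) (c / (norm v + 2))"
      have "0 < e" "e < 1" "e \<le> c / (norm v + 2)" using c pos by (auto simp: e_def)
      moreover from this have "e * (norm v + 2) \<le> c" using pos by (simp add: field_simps)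
      ultimately show "norm n \<le> 0 + c" using bound[of e] by simp
    qed
    then show "v \<in> ?R" using y(1) by (simp add: n_def)
  qed
qed

end

lemma tangent_space_subset_eucl:
  assumes "M \<subseteq> eucl D"
  shows "tangent_space M p \<subseteq> eucl D"
proof
  fix v assume "v \<in> tangent_space M p"
  then obtain \<gamma> \<delta> where \<gamma>: "\<delta> > 0" "\<gamma> ` {-\<delta><..<\<delta>} \<subseteq> M" "(\<gamma> has_vector_derivative v) (at (0::real))"
    by (auto simp: tangent_space_def)
  have "coord v i = 0" if "D \<le> i" for i
  proof -
    have "((\<lambda>t. inner (axis_fseq i) (\<gamma> t)) has_vector_derivative inner (axis_fseq i) v) (at 0)"
      by (rule bounded_linear.has_vector_derivative[OF bounded_linear_inner_right \<gamma>(3)])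
    then have "((\<lambda>t. coord (\<gamma> t) i) has_real_derivative coord v i) (at 0)"
      by (simp add: has_real_derivative_iff_has_vector_derivative)
    moreover have "coord (\<gamma> t) i = 0" if "\<bar>0 - t\<bar> < \<delta>" for t
    proof -
      have "t \<in> {-\<delta><..<\<delta>}" using that by auto
      then have "\<gamma> t \<in> eucl D" using \<gamma>(2) assms by blast
      then show ?thesis using \<open>D \<le> i\<close> by (simp add: eucl_def)
    qed
    ultimately show ?thesis
      using DERIV_local_const[of "\<lambda>t. coord (\<gamma> t) i" _ 0 \<delta>] \<gamma>(1) by simp
  qed
  then show "v \<in> eucl D" by (simp add: eucl_def)
qed

lemma submanifold_chartE:
  assumes "submanifold D d M" "p \<in> M"
  obtains U W \<phi> \<psi> \<phi>' w where "openin (top_of_set (eucl d)) W" "openin (top_of_set M) U"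
    "homeomorphism W U \<phi> \<psi>" "continuous_on W \<phi>'"
    "\<And>w. w \<in> W \<Longrightarrow> (\<phi> has_derivative blinfun_apply (\<phi>' w)) (at w within W)"
    "\<And>w. w \<in> W \<Longrightarrow> inj_on (blinfun_apply (\<phi>' w)) (eucl d)" "w \<in> W" "\<phi> w = p"
proof -
  obtain U W \<phi> \<psi> where c: "p \<in> U" "openin (top_of_set M) U" "openin (top_of_set (eucl d)) W"
      "homeomorphism W U \<phi> \<psi>" "C1_immersion d W \<phi>"
    using assms unfolding submanifold_def by blast
  then obtain w where "w \<in> W" "\<phi> w = p"
    unfolding homeomorphism_def by blast
  moreover obtain \<phi>' :: "fseq \<Rightarrow> fseq \<Rightarrow>\<^sub>L fseq" where "continuous_on W \<phi>'"
    "\<And>w. w \<in> W \<Longrightarrow> (\<phi> has_derivative blinfun_apply (\<phi>' w)) (at w within W)"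
    "\<And>w. w \<in> W \<Longrightarrow> inj_on (blinfun_apply (\<phi>' w)) (eucl d)"
    using c(5) unfolding C1_immersion_def by blast
  ultimately show ?thesis using that c by blast
qed

text \<open>The definition by curves shows none of these directly. All three are inherited from the
  description as the image of \<open>eucl d\<close> under the derivative of one chart.\<close>

lemma
  assumes M: "submanifold D d M" "p \<in> M"
  shows subspace_tangent_space: "subspace (tangent_space M p)"
    and dim_tangent_space: "dim (tangent_space M p) = d"
    and tangent_space_approx: "0 < e \<Longrightarrow> \<exists>r>0. \<forall>b\<in>M. dist b p < r \<longrightarrow>
      (\<exists>u\<in>tangent_space M p. norm (b - p - u) \<le> e * norm (b - p))"
proof -
  obtain U W \<phi> \<psi> \<phi>' w where c: "openin (top_of_set (eucl d)) W" "openin (top_of_set M) U"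
    "homeomorphism W U \<phi> \<psi>" "continuous_on W \<phi>'"
    "\<And>w. w \<in> W \<Longrightarrow> (\<phi> has_derivative blinfun_apply (\<phi>' w)) (at w within W)"
    "\<And>w. w \<in> W \<Longrightarrow> inj_on (blinfun_apply (\<phi>' w)) (eucl d)" "w \<in> W" "\<phi> w = p"
    using submanifold_chartE[OF M] by metis
  have T: "tangent_space M p = blinfun_apply (\<phi>' w) ` eucl d"
    using chart_tangent_space[OF c(1-7)] c(8) by simp
  have lin: "linear (blinfun_apply (\<phi>' w))"
    by (rule bounded_linear.linear[OF blinfun.bounded_linear_right])
  show "subspace (tangent_space M p)"
    unfolding T by (rule linear_subspace_image[OF lin subspace_eucl])
  show "dim (tangent_space M p) = d"
    unfolding T using dim_inj_image_eucl[OF lin c(6)[OF c(7)] subspace_eucl order.refl] by simp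
  show "0 < e \<Longrightarrow> \<exists>r>0. \<forall>b\<in>M. dist b p < r \<longrightarrow>
      (\<exists>u\<in>tangent_space M p. norm (b - p - u) \<le> e * norm (b - p))"
    unfolding T using chart_tangent_approx[OF c(1-7)] c(8) by simp
qed

text \<open>Since \<open>\<Phi>\<close> carries charts of \<open>M\<close> to charts of the image, no smoothness of its inverse is
  needed for the tangent spaces.\<close>

lemma
  fixes \<Phi>' :: "fseq \<Rightarrow> fseq \<Rightarrow>\<^sub>L fseq"
  assumes M: "submanifold D d M" and hom: "homeomorphism M M' \<Phi> \<Psi>" and M': "M' \<subseteq> eucl D"
    and deriv: "\<And>x. (\<Phi> has_derivative blinfun_apply (\<Phi>' x)) (at x)"
    and cont: "continuous_on UNIV \<Phi>'" and inj: "\<And>x. inj (blinfun_apply (\<Phi>' x))"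
  shows submanifold_image: "submanifold D d M'"
    and tangent_space_image: "p \<in> M \<Longrightarrow> tangent_space M' (\<Phi> p) = blinfun_apply (\<Phi>' p) ` tangent_space M p"
proof -
  \<comment> \<open>Each chart is composed with \<open>\<Phi>\<close> and differentiated by the
    chain rule. Both claims draw on the same chart, so all its data are collected in one
    statement.\<close>
  have img: "\<exists>U' W \<psi>' w \<phi>'' \<phi> \<phi>'. openin (top_of_set M') U' \<and> openin (top_of_set (eucl d)) W \<and>
      homeomorphism W U' (\<Phi> \<circ> \<phi>) \<psi>' \<and> continuous_on W \<phi>'' \<and>
      (\<forall>w\<in>W. ((\<Phi> \<circ> \<phi>) has_derivative blinfun_apply (\<phi>'' w)) (at w within W) \<and>
        inj_on (blinfun_apply (\<phi>'' w)) (eucl d)) \<and> w \<in> W \<and> \<phi> w = p \<and>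
      \<phi>'' w = \<Phi>' p o\<^sub>L \<phi>' \<and> tangent_space M p = blinfun_apply \<phi>' ` eucl d"
    if p: "p \<in> M" for p
  proof -
    obtain U W \<phi> \<psi> \<phi>' w where c: "openin (top_of_set (eucl d)) W" "openin (top_of_set M) U"
      "homeomorphism W U \<phi> \<psi>" "continuous_on W \<phi>'"
      "\<And>w. w \<in> W \<Longrightarrow> (\<phi> has_derivative blinfun_apply (\<phi>' w)) (at w within W)"
      "\<And>w. w \<in> W \<Longrightarrow> inj_on (blinfun_apply (\<phi>' w)) (eucl d)" "w \<in> W" "\<phi> w = p"
      using submanifold_chartE[OF M p] by metis
    have UM: "U \<subseteq> M" using c(2) openin_imp_subset by blast
    have "homeomorphism U (\<Phi> ` U) \<Phi> \<Psi>"
      using homeomorphism_of_subsets[OF hom UM] hom UM by (auto simp: homeomorphism_def)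
    then have h: "homeomorphism W (\<Phi> ` U) (\<Phi> \<circ> \<phi>) (\<psi> \<circ> \<Psi>)"
      by (rule homeomorphism_compose[OF c(3)])
    have o: "openin (top_of_set M') (\<Phi> ` U)"
      using homeomorphism_imp_open_map[OF hom c(2)] .
    define \<phi>'' where "\<phi>'' x = \<Phi>' (\<phi> x) o\<^sub>L \<phi>' x" for x
    have d: "((\<Phi> \<circ> \<phi>) has_derivative blinfun_apply (\<phi>'' x)) (at x within W)" if "x \<in> W" for x
    proof -
      have "(\<Phi> has_derivative blinfun_apply (\<Phi>' (\<phi> x))) (at (\<phi> x) within \<phi> ` W)"
        using deriv has_derivative_at_withinI by blast
      from diff_chain_within[OF c(5)[OF that] this] show ?thesis
        by (simp add: \<phi>''_def o_def blinfun_compose.rep_eq)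
    qed
    have i: "inj_on (blinfun_apply (\<phi>'' x)) (eucl d)" if "x \<in> W" for x
      using c(6)[OF that] inj[of "\<phi> x"] by (auto simp: \<phi>''_def inj_on_def)
    have k: "continuous_on W \<phi>''"
    proof -
      have "continuous_on W \<phi>" using c(3) by (simp add: homeomorphism_def)
      then have "continuous_on W (\<lambda>x. \<Phi>' (\<phi> x))"
        using continuous_on_compose2[OF cont] by blast
      then show ?thesis unfolding \<phi>''_def using c(4)
        by (rule bounded_bilinear.continuous_on[OF bounded_bilinear_blinfun_compose])
    qed
    have "\<phi>'' w = \<Phi>' p o\<^sub>L \<phi>' w" by (simp add: \<phi>''_def c)
    moreover have "tangent_space M p = blinfun_apply (\<phi>' w) ` eucl d"
      using chart_tangent_space[OF c(1-7)] c(8) by simp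
    ultimately show ?thesis using o c(1,7,8) h k d i by blast
  qed
  show "submanifold D d M'"
    unfolding submanifold_def
  proof (intro conjI ballI)
    fix q assume "q \<in> M'"
    then obtain p where p: "p \<in> M" "q = \<Phi> p" using hom by (auto simp: homeomorphism_def)
    obtain U' W \<psi>' w and \<phi>'' :: "fseq \<Rightarrow> fseq \<Rightarrow>\<^sub>L fseq" and \<phi> where c: "openin (top_of_set M') U'"
      "openin (top_of_set (eucl d)) W" "homeomorphism W U' (\<Phi> \<circ> \<phi>) \<psi>'" "continuous_on W \<phi>''"
      "\<forall>w\<in>W. ((\<Phi> \<circ> \<phi>) has_derivative blinfun_apply (\<phi>'' w)) (at w within W) \<and>
        inj_on (blinfun_apply (\<phi>'' w)) (eucl d)" "w \<in> W" "\<phi> w = p"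
      using img[OF p(1)] by blast
    have "q \<in> U'" using c(3,6,7) p by (force simp: homeomorphism_def)
    moreover have "C1_immersion d W (\<Phi> \<circ> \<phi>)"
      unfolding C1_immersion_def using c(4,5) by blast
    ultimately show "\<exists>U W \<phi> \<psi>. q \<in> U \<and> openin (top_of_set M') U \<and>
        openin (top_of_set (eucl d)) W \<and> homeomorphism W U \<phi> \<psi> \<and> C1_immersion d W \<phi>"
      using c(1-3) by blast
  qed (rule M')
  show "tangent_space M' (\<Phi> p) = blinfun_apply (\<Phi>' p) ` tangent_space M p" if p: "p \<in> M"
  proof -
    obtain U' W \<psi>' w and \<phi>'' :: "fseq \<Rightarrow> fseq \<Rightarrow>\<^sub>L fseq" and \<phi> \<phi>' where c: "openin (top_of_set M') U'"
      "openin (top_of_set (eucl d)) W" "homeomorphism W U' (\<Phi> \<circ> \<phi>) \<psi>'" "continuous_on W \<phi>''"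
      "\<forall>w\<in>W. ((\<Phi> \<circ> \<phi>) has_derivative blinfun_apply (\<phi>'' w)) (at w within W) \<and>
        inj_on (blinfun_apply (\<phi>'' w)) (eucl d)" "w \<in> W" "\<phi> w = p"
      "\<phi>'' w = \<Phi>' p o\<^sub>L \<phi>'" "tangent_space M p = blinfun_apply \<phi>' ` eucl d"
      using img[OF p] by blast
    have "tangent_space M' ((\<Phi> \<circ> \<phi>) w) = blinfun_apply (\<phi>'' w) ` eucl d"
      by (rule chart_tangent_space[OF c(2,1,3,4) _ _ c(6)]) (use c(5) in auto)
    then show ?thesis
      using c(7-9) by (simp add: image_image)
  qed
qed

section \<open>Small perturbations of the identity\<close>

text \<open>The isotopies are composed at equal times instead of run one after the other, so no
  reparametrisation or gluing in time is involved.\<close>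

lemma ambient_isotopic_trans:
  assumes A: "A \<subseteq> eucl D" and "ambient_isotopic D A B" "ambient_isotopic D B C"
  shows "ambient_isotopic D A C"
proof -
  obtain F where F: "continuous_on ({0..1} \<times> eucl D) (\<lambda>(t, x). F t x)"
      "\<forall>t\<in>{0..1::real}. \<exists>G. homeomorphism (eucl D) (eucl D) (F t) G"
      "\<forall>x\<in>eucl D. F 0 x = x" "F 1 ` A = B"
    using assms(2) unfolding ambient_isotopic_def by blast
  obtain H where H: "continuous_on ({0..1} \<times> eucl D) (\<lambda>(t, x). H t x)"
      "\<forall>t\<in>{0..1::real}. \<exists>G. homeomorphism (eucl D) (eucl D) (H t) G"
      "\<forall>x\<in>eucl D. H 0 x = x" "H 1 ` B = C"
    using assms(3) unfolding ambient_isotopic_def by blast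
  have FE: "F t x \<in> eucl D" if "t \<in> {0..1}" "x \<in> eucl D" for t x
    using F(2) that unfolding homeomorphism_def by blast
  have "continuous_on ({0..1} \<times> eucl D) (\<lambda>z. (\<lambda>(t, x). H t x) (fst z, (\<lambda>(t, x). F t x) z))"
  proof (rule continuous_on_compose2[OF H(1)])
    show "continuous_on ({0..1} \<times> eucl D) (\<lambda>z. (fst z, (\<lambda>(t, x). F t x) z))"
      by (intro continuous_intros F(1))
  qed (auto simp: FE)
  then have "continuous_on ({0..1} \<times> eucl D) (\<lambda>(t, x). H t (F t x))"
    by (simp add: case_prod_unfold)
  moreover have "\<exists>G. homeomorphism (eucl D) (eucl D) (\<lambda>x. H t (F t x)) G" if "t \<in> {0..1}" for t
    using F(2) H(2) that homeomorphism_compose unfolding o_def by blast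
  moreover have "(\<lambda>x. H 1 (F 1 x)) ` A = C"
    by (simp only: image_image[symmetric] F(4) H(4))
  ultimately show ?thesis
    unfolding ambient_isotopic_def using F(3) H(3)
    by (intro exI[of _ "\<lambda>t x. H t (F t x)"] conjI ballI) simp_all
qed

text \<open>\<open>G\<close> is a displacement field, to be added to the identity. The bound on
  \<open>G'\<close> keeps the sum injective, and \<open>R\<close> measures how strongly it bends a
  manifold, that is, the loss of reach.\<close>

locale small_perturbation =
  fixes D :: nat and G :: "fseq \<Rightarrow> fseq" and G' :: "fseq \<Rightarrow> fseq \<Rightarrow>\<^sub>L fseq" and R :: real
  assumes G_eucl: "x \<in> eucl D \<Longrightarrow> G x \<in> eucl D"
    and G_deriv: "(G has_derivative blinfun_apply (G' x)) (at x)"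
    and G'_bound: "norm (G' x) \<le> 1/10"
    and G'_lipschitz: "norm (G' x - G' y) \<le> R * norm (x - y)"
begin

lemma G_lipschitz: "norm (G x - G y) \<le> 1/10 * norm (x - y)"
  by (rule differentiable_bound[where f' = "\<lambda>x. blinfun_apply (G' x)" and S = UNIV])
    (use G_deriv G'_bound in \<open>auto simp flip: norm_blinfun.rep_eq\<close>)

lemma R_nonneg: "0 \<le> R"
proof -
  obtain x :: fseq where "norm x = 1" using norm_axis_fseq by blast
  then show ?thesis
    using order.trans[OF norm_ge_zero G'_lipschitz[of x 0]] by simp
qed

definition \<Phi> where "\<Phi> x = x + G x"

definition \<Phi>' where "\<Phi>' x = id_blinfun + G' x"

lemma \<Phi>_deriv: "(\<Phi> has_derivative blinfun_apply (\<Phi>' x)) (at x)"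
  unfolding \<Phi>_def[abs_def] \<Phi>'_def using G_deriv
  by (auto intro!: derivative_eq_intros simp: blinfun.add_left)

lemma continuous_\<Phi>': "continuous_on UNIV \<Phi>'"
  unfolding continuous_on_iff
proof (intro ballI allI impI)
  fix x :: fseq and e :: real assume e: "0 < e"
  have "dist (\<Phi>' y) (\<Phi>' x) < e" if "dist y x < e / (R + 1)" for y
  proof -
    have "dist (\<Phi>' y) (\<Phi>' x) \<le> R * norm (y - x)"
      using G'_lipschitz by (simp add: \<Phi>'_def dist_norm)
    also have "\<dots> \<le> (R + 1) * norm (y - x)" by (intro mult_right_mono) auto
    also have "\<dots> < e"
      using that R_nonneg by (simp add: dist_norm field_simps)
    finally show ?thesis .
  qed
  then show "\<exists>d>0. \<forall>y\<in>UNIV. dist y x < d \<longrightarrow> dist (\<Phi>' y) (\<Phi>' x) < e"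
    using e R_nonneg by (intro exI[of _ "e / (R + 1)"]) (auto intro!: divide_pos_pos)
qed

lemma \<Phi>'_lower: "9/10 * norm h \<le> norm (\<Phi>' x h)"
proof -
  have "norm (G' x h) \<le> 1/10 * norm h"
    using norm_blinfun[of "G' x" h] mult_right_mono[OF G'_bound[of x] norm_ge_zero[of h]] by linarith
  then show ?thesis
    using norm_triangle_ineq4[of "h + G' x h" "G' x h"] by (simp add: \<Phi>'_def blinfun.add_left)
qed

lemma \<Phi>'_upper: "norm (\<Phi>' x h) \<le> 11/10 * norm h"
proof -
  have "norm (G' x h) \<le> 1/10 * norm h"
    using norm_blinfun[of "G' x" h] mult_right_mono[OF G'_bound[of x] norm_ge_zero[of h]] by linarith
  then show ?thesis
    using norm_triangle_ineq[of h "G' x h"] by (simp add: \<Phi>'_def blinfun.add_left)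
qed

lemma inj_\<Phi>': "inj (blinfun_apply (\<Phi>' x))"
proof (rule injI)
  fix a b assume "\<Phi>' x a = \<Phi>' x b"
  then have "\<Phi>' x (a - b) = 0" by (simp add: blinfun.diff_right)
  then show "a = b" using \<Phi>'_lower[of "a - b" x] by simp
qed

lemma \<Phi>_lower: "9/10 * norm (x - y) \<le> norm (\<Phi> x - \<Phi> y)"
proof -
  have "norm (x - y) \<le> norm (\<Phi> x - \<Phi> y) + norm (G x - G y)"
    using norm_triangle_ineq4[of "\<Phi> x - \<Phi> y" "G x - G y"] by (simp add: \<Phi>_def)
  then show ?thesis using G_lipschitz[of x y] by simp
qed

text \<open>The mean value inequality for the derivative on a ball loses a factor 2 against the
  sharp constant \<open>R / 2\<close>, which the later estimates can afford.\<close>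

lemma \<Phi>_taylor: "norm (\<Phi> b - \<Phi> a - \<Phi>' a (b - a)) \<le> R * (norm (b - a))\<^sup>2"
proof -
  let ?S = "cball a (norm (b - a))"
  have "norm (\<Phi> b - \<Phi> a - \<Phi>' a (b - a)) \<le> norm (b - a) * (R * norm (b - a))"
  proof (rule differentiable_bound_linearization[where S = ?S and f' = "\<lambda>x. blinfun_apply (\<Phi>' x)"])
    show "a + t *\<^sub>R (b - a) \<in> ?S" if "t \<in> {0..1}" for t
      using that by (simp add: dist_norm mult_left_le_one_le)
    show "(\<Phi> has_derivative blinfun_apply (\<Phi>' x)) (at x within ?S)" for x
      by (rule has_derivative_at_withinI[OF \<Phi>_deriv])
    show "onorm (blinfun_apply (\<Phi>' x) - blinfun_apply (\<Phi>' a)) \<le> R * norm (b - a)" if "x \<in> ?S" for x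
    proof -
      have "blinfun_apply (\<Phi>' x) - blinfun_apply (\<Phi>' a) = blinfun_apply (\<Phi>' x - \<Phi>' a)"
        by (simp add: fun_eq_iff blinfun.diff_left)
      then have "onorm (blinfun_apply (\<Phi>' x) - blinfun_apply (\<Phi>' a)) = norm (\<Phi>' x - \<Phi>' a)"
        by (simp add: norm_blinfun.rep_eq)
      also have "\<dots> \<le> R * norm (x - a)" using G'_lipschitz by (simp add: \<Phi>'_def)
      also have "\<dots> \<le> R * norm (b - a)"
        using that R_nonneg by (intro mult_left_mono) (simp_all add: dist_norm norm_minus_commute)
      finally show ?thesis .
    qed
  qed simp
  then show ?thesis by (simp add: power2_eq_square mult.left_commute)
qed

text \<open>These are the stages of the straight-line isotopy. Distances shrink by a factor of at
  least \<open>9/10\<close>, whence injectivity and a Lipschitz inverse. A preimage of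
  \<open>y\<close> is a fixed point of the contraction sending \<open>x\<close> to
  \<open>y - t G x\<close>.\<close>

lemma homeomorphism_eucl:
  assumes t: "t \<in> {0..1}"
  shows "\<exists>H. homeomorphism (eucl D) (eucl D) (\<lambda>x. x + t *\<^sub>R G x) H"
proof -
  let ?f = "\<lambda>x. x + t *\<^sub>R G x"
  have tG: "norm (t *\<^sub>R G x - t *\<^sub>R G y) \<le> 1/10 * norm (x - y)" for x y
  proof -
    have "norm (t *\<^sub>R G x - t *\<^sub>R G y) = t * norm (G x - G y)"
      using t by (simp flip: scaleR_diff_right)
    also have "\<dots> \<le> 1 * norm (G x - G y)" using t by (intro mult_right_mono) auto
    finally show ?thesis using G_lipschitz[of x y] by simp
  qed
  have low: "9/10 * norm (x - y) \<le> norm (?f x - ?f y)" for x y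
  proof -
    have "norm (x - y) \<le> norm (?f x - ?f y) + norm (t *\<^sub>R G x - t *\<^sub>R G y)"
      using norm_triangle_ineq4[of "?f x - ?f y" "t *\<^sub>R G x - t *\<^sub>R G y"] by simp
    then show ?thesis using tG[of x y] by simp
  qed
  have inj: "inj ?f"
  proof (rule injI)
    fix x y assume "?f x = ?f y"
    then have "norm (?f x - ?f y) = 0" by simp
    then show "x = y" using low[of x y] by simp
  qed
  have fE: "?f x \<in> eucl D" if "x \<in> eucl D" for x
    using that G_eucl by (intro eucl_add eucl_scale)
  have surj: "\<exists>x\<in>eucl D. ?f x = y" if y: "y \<in> eucl D" for y
  proof -
    have "\<exists>!x\<in>eucl D. y - t *\<^sub>R G x = x"
    proof (rule Banach_fix)
      show "complete (eucl D)" by (rule complete_eucl)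
      show "eucl D \<noteq> {}" using zero_in_eucl by blast
      show "(0::real) \<le> 1/10" "(1/10::real) < 1" by simp_all
      show "(\<lambda>x. y - t *\<^sub>R G x) ` eucl D \<subseteq> eucl D"
        using y G_eucl by (auto intro!: eucl_diff eucl_scale)
      show "dist (y - t *\<^sub>R G x) (y - t *\<^sub>R G z) \<le> 1/10 * dist x z" for x z
        using tG[of z x] by (simp add: dist_norm norm_minus_commute)
    qed
    then obtain x where "x \<in> eucl D" "y - t *\<^sub>R G x = x" by blast
    then have "?f x = y" by (metis diff_add_cancel)
    then show ?thesis using \<open>x \<in> eucl D\<close> by blast
  qed
  define H where "H = inv_into (eucl D) ?f"
  have HE: "H y \<in> eucl D" "?f (H y) = y" if "y \<in> eucl D" for y
    using surj[OF that] unfolding H_def by (auto intro!: inv_into_into f_inv_into_f)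
  have Hf: "H (?f x) = x" if "x \<in> eucl D" for x
    unfolding H_def by (rule inv_into_f_f[OF inj_on_subset[OF inj] that]) simp
  have contf: "continuous_on S ?f" for S
  proof -
    have "continuous_on S G"
      by (rule continuous_at_imp_continuous_on) (use has_derivative_continuous[OF G_deriv] in auto)
    then show ?thesis by (intro continuous_intros)
  qed
  have contH: "continuous_on (eucl D) H"
    unfolding continuous_on_iff
  proof (intro ballI allI impI)
    fix x :: fseq and e :: real assume x: "x \<in> eucl D" and e: "0 < e"
    have "dist (H y) (H x) < e" if "y \<in> eucl D" "dist y x < e / 2" for y
      using low[of "H y" "H x"] HE(2)[OF x] HE(2)[OF that(1)] that e by (simp add: dist_norm)
    then show "\<exists>d>0. \<forall>x'\<in>eucl D. dist x' x < d \<longrightarrow> dist (H x') (H x) < e"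
      using e by (intro exI[of _ "e / 2"]) auto
  qed
  have "homeomorphism (eucl D) (eucl D) ?f H"
    by (rule homeomorphismI[OF contf contH]) (use HE fE Hf in auto)
  then show ?thesis by blast
qed

lemma ambient_isotopic_image: "ambient_isotopic D M (\<Phi> ` M)"
proof -
  have "continuous_on UNIV G"
    by (rule continuous_at_imp_continuous_on) (use has_derivative_continuous[OF G_deriv] in auto)
  then have "continuous_on ({0..1::real} \<times> eucl D) (\<lambda>z. snd z + fst z *\<^sub>R G (snd z))"
    by (intro continuous_intros continuous_on_compose2[of UNIV G _ snd]) auto
  then show ?thesis
    unfolding ambient_isotopic_def using homeomorphism_eucl
    by (intro exI[of _ "\<lambda>t x. x + t *\<^sub>R G x"]) (auto simp: case_prod_unfold \<Phi>_def)
qed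

context
  fixes M :: "fseq set" and d :: nat and \<rho> :: real
  assumes M: "M \<in> manifolds D d \<rho>" and \<rho>: "0 < \<rho>" and R: "R \<le> 1 / (2 * \<rho>)"
begin

lemma homeomorphism_image_manifold: "\<exists>\<Psi>. homeomorphism M (\<Phi> ` M) \<Phi> \<Psi>"
proof (rule homeomorphism_compact)
  show "compact M" using M by (simp add: manifolds_def)
  show "continuous_on M \<Phi>"
    by (rule continuous_at_imp_continuous_on) (use has_derivative_continuous[OF \<Phi>_deriv] in auto)
  show "inj_on \<Phi> M"
  proof (rule inj_onI)
    fix x y assume "\<Phi> x = \<Phi> y"
    then show "x = y" using \<Phi>_lower[of x y] by simp
  qed
qed simp

lemma image_subset_eucl: "\<Phi> ` M \<subseteq> eucl D"
  using M G_eucl by (auto simp: manifolds_def submanifold_def \<Phi>_def intro!: eucl_add)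

lemma tangent_space_\<Phi>: "p \<in> M \<Longrightarrow> tangent_space (\<Phi> ` M) (\<Phi> p) = blinfun_apply (\<Phi>' p) ` tangent_space M p"
  using homeomorphism_image_manifold M
    tangent_space_image[OF _ _ image_subset_eucl \<Phi>_deriv continuous_\<Phi>' inj_\<Phi>']
  by (metis (no_types, lifting) manifolds_def mem_Collect_eq)

text \<open>A tangent vector that approximates \<open>b - a\<close> is pushed forward by the
  derivative at \<open>a\<close>. The Taylor error and the pushed error are both quadratic in the
  distance, so the estimate characterising reach survives with a worse constant.\<close>

lemma manifolds_image: "\<Phi> ` M \<in> manifolds D d (\<rho> / 4)"
proof -
  have M': "submanifold D d M" "compact M" "connected M" "M \<noteq> {}" "ereal \<rho> \<le> reach D M"
    using M by (auto simp: manifolds_def)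
  then have ME: "M \<subseteq> eucl D" by (simp add: submanifold_def)
  have cont: "continuous_on M \<Phi>"
    by (rule continuous_at_imp_continuous_on) (use has_derivative_continuous[OF \<Phi>_deriv] in auto)
  have "submanifold D d (\<Phi> ` M)"
    using homeomorphism_image_manifold
      submanifold_image[OF M'(1) _ image_subset_eucl \<Phi>_deriv continuous_\<Phi>' inj_\<Phi>'] by blast
  moreover have "compact (\<Phi> ` M)" "connected (\<Phi> ` M)"
    using M' cont by (auto intro: compact_continuous_image connected_continuous_image)
  moreover have "ereal (\<rho> / 4) \<le> reach D (\<Phi> ` M)"
  proof (rule tangent_estimate_imp_reach)
    show "compact (\<Phi> ` M)" "\<Phi> ` M \<noteq> {}" "0 < \<rho> / 4"
      using M' cont \<rho> by (auto intro: compact_continuous_image)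
    fix a' b' assume "a' \<in> \<Phi> ` M" "b' \<in> \<Phi> ` M"
    then obtain a b where ab: "a \<in> M" "b \<in> M" "a' = \<Phi> a" "b' = \<Phi> b" by blast
    have "\<exists>t\<in>tangent_space M a. norm (b - a - t) \<le> (norm (b - a))\<^sup>2 / (2 * \<rho>)"
      by (rule reach_imp_tangent_estimate[OF M'(2,4) ME M'(5) ab(1,2)])
        (use subspace_tangent_space[OF M'(1) ab(1)] tangent_space_subset_eucl[OF ME] \<rho>
          tangent_space_approx[OF M'(1) ab(1)] in auto)
    then obtain t where t: "t \<in> tangent_space M a" "norm (b - a - t) \<le> (norm (b - a))\<^sup>2 / (2 * \<rho>)"
      by blast
    have "\<Phi>' a t \<in> tangent_space (\<Phi> ` M) a'"
      using tangent_space_\<Phi>[OF ab(1)] t ab by auto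
    moreover have "norm (b' - a' - \<Phi>' a t) \<le> (norm (b' - a'))\<^sup>2 / (2 * (\<rho> / 4))"
    proof -
      have "b' - a' - \<Phi>' a t = (\<Phi> b - \<Phi> a - \<Phi>' a (b - a)) + \<Phi>' a (b - a - t)"
        by (simp add: ab blinfun.diff_right)
      then have "norm (b' - a' - \<Phi>' a t) \<le> R * (norm (b - a))\<^sup>2 + 11/10 * norm (b - a - t)"
        using norm_triangle_ineq[of "\<Phi> b - \<Phi> a - \<Phi>' a (b - a)" "\<Phi>' a (b - a - t)"]
          \<Phi>_taylor[of b a] \<Phi>'_upper[of a "b - a - t"] by simp
      also have "\<dots> \<le> 1 / (2 * \<rho>) * (norm (b - a))\<^sup>2 + 11/10 * ((norm (b - a))\<^sup>2 / (2 * \<rho>))"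
        using R t(2) by (intro add_mono mult_left_mono mult_right_mono) auto
      also have "\<dots> = 21 / (20 * \<rho>) * (norm (b - a))\<^sup>2"
        using \<rho> by (simp add: field_simps)
      also have "\<dots> \<le> 21 / (20 * \<rho>) * (10 / 9 * norm (b' - a'))\<^sup>2"
        using \<Phi>_lower[of b a] ab \<rho> by (intro mult_left_mono power_mono) auto
      also have "\<dots> = 2100 / (1620 * \<rho>) * (norm (b' - a'))\<^sup>2"
        by (simp add: power_mult_distrib power_divide)
      \<comment> \<open>The factor \<open>2100 / 1620\<close> is below 2, and
        \<open>2 / \<rho>\<close> is the constant that belongs to reach
        \<open>\<rho> / 4\<close>.\<close>
      also have "\<dots> \<le> 2 / \<rho> * (norm (b' - a'))\<^sup>2"
        using \<rho> by (intro mult_right_mono) (auto simp: field_simps)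
      finally show ?thesis by (simp add: mult.commute)
    qed
    ultimately show "\<exists>t\<in>tangent_space (\<Phi> ` M) a'. norm (b' - a' - t) \<le> (norm (b' - a'))\<^sup>2 / (2 * (\<rho> / 4))"
      by blast
  qed
  ultimately show ?thesis using M' by (simp add: manifolds_def)
qed

end

end

section \<open>Bump functions\<close>

text \<open>Squaring smooths the corner of the positive part: for all signs of \<open>s\<close> and
  \<open>t\<close> the first-order error is at most \<open>(t - s)\<^sup>2\<close>. This is why the
  bump is the square of \<open>\<sigma>\<close>.\<close>

lemma has_real_derivative_pos_part_power2:
  fixes s :: real
  shows "((\<lambda>s. (max 0 s)\<^sup>2) has_real_derivative 2 * max 0 s) (at s)"
proof -
  have bound: "\<bar>(max 0 t)\<^sup>2 - (max 0 s)\<^sup>2 - 2 * max 0 s * (t - s)\<bar> \<le> (t - s)\<^sup>2" for t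
  proof -
    consider "0 \<le> s" "0 \<le> t" | "0 \<le> s" "t < 0" | "s < 0" "0 \<le> t" | "s < 0" "t < 0" by linarith
    then show ?thesis
    proof cases
      case 2
      have "s * t \<le> 0" using 2 by (simp add: mult_nonneg_nonpos)
      then have "0 \<le> s\<^sup>2 - 2 * (s * t)" using zero_le_power2[of s] by linarith
      then show ?thesis using 2 by (simp add: power2_eq_square algebra_simps)
    next
      case 3
      have "t\<^sup>2 \<le> (t - s)\<^sup>2" using 3 by (intro power_mono) auto
      then show ?thesis using 3 by simp
    next
      case 1
      have "t\<^sup>2 - s\<^sup>2 - 2 * s * (t - s) = (t - s)\<^sup>2"
        by (simp add: power2_eq_square algebra_simps)
      then show ?thesis using 1 by simp
    next
      case 4
      then show ?thesis by simp
    qed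
  qed
  show ?thesis
    unfolding has_field_derivative_def has_derivative_at_alt
  proof (intro conjI allI impI)
    show "bounded_linear ((*) (2 * max 0 s))" by (rule bounded_linear_mult_right)
    fix e :: real assume e: "0 < e"
    have "norm ((max 0 t)\<^sup>2 - (max 0 s)\<^sup>2 - 2 * max 0 s * (t - s)) \<le> e * norm (t - s)"
      if "norm (t - s) < e" for t
    proof -
      have "(t - s)\<^sup>2 = norm (t - s) * norm (t - s)" by (simp add: power2_eq_square)
      also have "\<dots> \<le> e * norm (t - s)" using that by (intro mult_right_mono) auto
      finally show ?thesis using bound[of t] by simp
    qed
    then show "\<exists>d>0. \<forall>t. norm (t - s) < d \<longrightarrow>
        norm ((max 0 t)\<^sup>2 - (max 0 s)\<^sup>2 - 2 * max 0 s * (t - s)) \<le> e * norm (t - s)"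
      using e by blast
  qed
qed

text \<open>The perturbation near one sample point: \<open>e\<close> is the displacement of the
  centre, \<open>A\<close> the change of the derivative there, and \<open>r\<close> the radius of
  the support.\<close>

locale bump =
  fixes r :: real and e :: fseq and A :: "fseq \<Rightarrow>\<^sub>L fseq" and \<eta> \<theta> :: real
  assumes r: "0 < r" and e: "norm e \<le> \<eta>" and A: "norm A \<le> \<theta>"
begin

definition \<sigma> :: "fseq \<Rightarrow> real" where
  "\<sigma> y = max 0 (1 - inner y y / r\<^sup>2)"

definition g :: "fseq \<Rightarrow> fseq" where
  "g y = (\<sigma> y)\<^sup>2 *\<^sub>R (e + A y)"

text \<open>The factor \<open>\<sigma> y *\<^sub>R y\<close> is kept together because it is bounded
  by \<open>r\<close> and globally Lipschitz, whereas \<open>y\<close> alone is unbounded.\<close>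

definition g' :: "fseq \<Rightarrow> fseq \<Rightarrow>\<^sub>L fseq" where
  "g' y = Blinfun (\<lambda>h. (\<sigma> y)\<^sup>2 *\<^sub>R A h - (4 / r\<^sup>2 * inner (\<sigma> y *\<^sub>R y) h) *\<^sub>R (e + A y))"

lemma g'_apply: "g' y h = (\<sigma> y)\<^sup>2 *\<^sub>R A h - (4 / r\<^sup>2 * inner (\<sigma> y *\<^sub>R y) h) *\<^sub>R (e + A y)"
  unfolding g'_def
  by (rule bounded_linear_Blinfun_apply[THEN fun_cong])
    (intro bounded_linear_sub bounded_linear_const_scaleR bounded_linear_scaleR_const
      bounded_linear_const_mult bounded_linear_inner_right blinfun.bounded_linear_right)

lemma nonneg: "0 \<le> \<eta>" "0 \<le> \<theta>"
  using order.trans[OF norm_ge_zero e] order.trans[OF norm_ge_zero A] by auto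

lemma A_bound: "norm (A h) \<le> \<theta> * norm h"
  using norm_blinfun[of A h] mult_right_mono[OF A norm_ge_zero[of h]] by linarith

lemma \<sigma>_range: "0 \<le> \<sigma> y" "\<sigma> y \<le> 1"
  by (auto simp: \<sigma>_def)

lemma \<sigma>_outside: "r \<le> norm y \<Longrightarrow> \<sigma> y = 0"
proof -
  assume "r \<le> norm y"
  then have "r\<^sup>2 \<le> inner y y"
    using r power_mono[of r "norm y" 2] by (simp add: power2_norm_eq_inner)
  then have "1 \<le> inner y y / r\<^sup>2"
    using r by (simp add: field_simps)
  then show ?thesis by (simp add: \<sigma>_def)
qed

lemma g_deriv: "(g has_derivative blinfun_apply (g' y)) (at y)"
proof -
  have "((\<lambda>y. 1 - inner y y / r\<^sup>2) has_derivative (\<lambda>h. - 2 * inner y h / r\<^sup>2)) (at y)"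
    using r by (auto intro!: derivative_eq_intros
        simp: inner_commute fun_eq_iff field_simps power2_eq_square power4_eq_xxxx)
  then have "((\<lambda>y. (\<sigma> y)\<^sup>2) has_derivative (\<lambda>h. (- 2 * inner y h / r\<^sup>2) * (2 * \<sigma> y))) (at y)"
    unfolding \<sigma>_def by (rule DERIV_compose_FDERIV[OF has_real_derivative_pos_part_power2])
  moreover have "((\<lambda>y. e + A y) has_derivative (\<lambda>h. A h)) (at y)"
    by (auto intro!: derivative_eq_intros)
  ultimately have "((\<lambda>y. (\<sigma> y)\<^sup>2 *\<^sub>R (e + A y)) has_derivative
      (\<lambda>h. (\<sigma> y)\<^sup>2 *\<^sub>R A h + ((- 2 * inner y h / r\<^sup>2) * (2 * \<sigma> y)) *\<^sub>R (e + A y))) (at y)"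
    by (rule has_derivative_scaleR)
  then show ?thesis
    by (simp add: g_def[abs_def] g'_apply[abs_def] ac_simps)
qed

text \<open>With the norm truncated at \<open>r\<close>, the bump is
  \<open>1 - (c y)\<^sup>2 / r\<^sup>2\<close> everywhere. The truncated norm is 1-Lipschitz and at
  most \<open>r\<close>, so the difference of squares factors well.\<close>

lemma \<sigma>_lipschitz: "\<bar>\<sigma> y - \<sigma> z\<bar> \<le> 2 / r * norm (y - z)"
proof -
  define c where "c y = min (norm y) r" for y :: fseq
  have \<sigma>: "\<sigma> y = 1 - (c y)\<^sup>2 / r\<^sup>2" for y
  proof (cases "r \<le> norm y")
    case True
    then show ?thesis using \<sigma>_outside[OF True] r by (simp add: c_def)
  next
    case False
    then have "inner y y \<le> r\<^sup>2"
      using power_mono[of "norm y" r 2] by (simp add: power2_norm_eq_inner)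
    then show ?thesis
      using False r by (simp add: \<sigma>_def c_def power2_norm_eq_inner field_simps)
  qed
  have c: "0 \<le> c y" "c y \<le> r" for y using r by (auto simp: c_def)
  have "\<bar>\<sigma> y - \<sigma> z\<bar> = \<bar>(c z - c y) * (c z + c y)\<bar> / r\<^sup>2"
    using r by (simp add: \<sigma> field_simps power2_eq_square abs_mult flip: diff_divide_distrib)
  also have "\<dots> \<le> norm (y - z) * (2 * r) / r\<^sup>2"
  proof (intro divide_right_mono)
    have "\<bar>c z - c y\<bar> \<le> norm (y - z)"
      using norm_triangle_ineq3[of y z] by (auto simp: c_def)
    moreover have "\<bar>c z + c y\<bar> \<le> 2 * r" using c[of y] c[of z] by auto
    ultimately show "\<bar>(c z - c y) * (c z + c y)\<bar> \<le> norm (y - z) * (2 * r)"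
      unfolding abs_mult by (intro mult_mono) auto
  qed simp
  also have "\<dots> = 2 / r * norm (y - z)"
    using r by (simp add: power2_eq_square)
  finally show ?thesis .
qed

lemma \<sigma>_scaleR_bound: "norm (\<sigma> y *\<^sub>R y) \<le> r"
proof (cases "r \<le> norm y")
  case True
  then show ?thesis using \<sigma>_outside r by simp
next
  case False
  have "norm (\<sigma> y *\<^sub>R y) \<le> 1 * norm y"
    using \<sigma>_range[of y] by (simp add: mult_left_le_one_le)
  then show ?thesis using False by simp
qed

text \<open>Changing one factor at a time costs 1 for the vector and \<open>2 / r\<close> times
  \<open>r\<close> for the scalar, provided that one of the two points is in the ball. Otherwise
  both terms vanish.\<close>

lemma \<sigma>_scaleR_lipschitz: "norm (\<sigma> y *\<^sub>R y - \<sigma> z *\<^sub>R z) \<le> 3 * norm (y - z)"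
proof -
  have *: "norm (\<sigma> y *\<^sub>R y - \<sigma> z *\<^sub>R z) \<le> 3 * norm (y - z)" if z: "norm z \<le> r" for y z
  proof -
    have "\<sigma> y *\<^sub>R y - \<sigma> z *\<^sub>R z = \<sigma> y *\<^sub>R (y - z) + (\<sigma> y - \<sigma> z) *\<^sub>R z"
      by (simp add: algebra_simps)
    then have "norm (\<sigma> y *\<^sub>R y - \<sigma> z *\<^sub>R z) \<le> \<sigma> y * norm (y - z) + \<bar>\<sigma> y - \<sigma> z\<bar> * norm z"
      using norm_triangle_ineq[of "\<sigma> y *\<^sub>R (y - z)" "(\<sigma> y - \<sigma> z) *\<^sub>R z"] \<sigma>_range[of y] by simp
    also have "\<dots> \<le> 1 * norm (y - z) + (2 / r * norm (y - z)) * r"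
      using \<sigma>_range \<sigma>_lipschitz z r by (intro add_mono mult_mono) auto
    finally show ?thesis using r by simp
  qed
  consider "norm z \<le> r" | "norm y \<le> r" | "r \<le> norm y" "r \<le> norm z" by linarith
  then show ?thesis
    by cases (use *[of z y] *[of y z] \<sigma>_outside in \<open>auto simp: norm_minus_commute\<close>)
qed

lemma affine_bound: "norm y \<le> r \<Longrightarrow> norm (e + A y) \<le> \<eta> + \<theta> * r"
  using norm_triangle_ineq[of e "A y"] e A_bound[of y] mult_left_mono[of "norm y" r \<theta>] nonneg by linarith

lemma g_bound: "norm (g y) \<le> \<eta> + \<theta> * r"
proof (cases "r \<le> norm y")
  case True
  then show ?thesis using \<sigma>_outside[OF True] nonneg r by (simp add: g_def)
next
  case False
  have "norm (g y) \<le> 1 * norm (e + A y)"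
    using \<sigma>_range[of y] by (simp add: g_def mult_left_le_one_le power_le_one)
  then show ?thesis using affine_bound[of y] False by simp
qed

text \<open>By the product rule, differentiating the affine part contributes \<open>\<theta>\<close>
  and differentiating the bump contributes \<open>4 / r * (\<eta> + \<theta> * r)\<close>.\<close>

lemma g'_bound: "norm (g' y) \<le> 5 * \<theta> + 4 * \<eta> / r"
proof (rule norm_blinfun_bound)
  show "0 \<le> 5 * \<theta> + 4 * \<eta> / r" using nonneg r by simp
  fix h
  show "norm (g' y h) \<le> (5 * \<theta> + 4 * \<eta> / r) * norm h"
  proof (cases "r \<le> norm y")
    case True
    then show ?thesis using \<sigma>_outside[OF True] nonneg r by (simp add: g'_apply)
  next
    case False
    have 1: "norm ((\<sigma> y)\<^sup>2 *\<^sub>R A h) \<le> 1 * (\<theta> * norm h)"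
      unfolding norm_scaleR using \<sigma>_range[of y] A_bound[of h]
      by (intro mult_mono) (auto simp: power_le_one)
    have "\<bar>inner (\<sigma> y *\<^sub>R y) h\<bar> \<le> r * norm h"
      using Cauchy_Schwarz_ineq2[of "\<sigma> y *\<^sub>R y" h] mult_right_mono[OF \<sigma>_scaleR_bound[of y] norm_ge_zero[of h]]
      by linarith
    then have "\<bar>4 / r\<^sup>2 * inner (\<sigma> y *\<^sub>R y) h\<bar> \<le> 4 / r\<^sup>2 * (r * norm h)"
      unfolding abs_mult by (intro mult_mono) auto
    then have 2: "norm ((4 / r\<^sup>2 * inner (\<sigma> y *\<^sub>R y) h) *\<^sub>R (e + A y)) \<le> 4 / r\<^sup>2 * (r * norm h) * (\<eta> + \<theta> * r)"
      unfolding norm_scaleR using affine_bound[of y] False r by (intro mult_mono) auto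
    have "norm (g' y h) \<le> 1 * (\<theta> * norm h) + 4 / r\<^sup>2 * (r * norm h) * (\<eta> + \<theta> * r)"
      unfolding g'_apply by (rule order.trans[OF norm_triangle_ineq4 add_mono[OF 1 2]])
    also have "\<dots> = (5 * \<theta> + 4 * \<eta> / r) * norm h"
      using r by (simp add: field_simps power2_eq_square)
    finally show ?thesis .
  qed
qed

lemma g'_outside: "r \<le> norm y \<Longrightarrow> g' y = 0"
  using \<sigma>_outside by (intro blinfun_eqI) (simp add: g'_apply)

text \<open>One factor is changed at a time. The three terms contribute
  \<open>4 * \<theta> / r\<close>, \<open>12 * (\<eta> + \<theta> * r) / r\<^sup>2\<close> and
  \<open>4 * \<theta> / r\<close>. The affine bound needs one point in the ball, which symmetry
  arranges unless both derivatives are 0.\<close>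

lemma g'_lipschitz: "norm (g' y - g' z) \<le> (12 * \<eta> / r\<^sup>2 + 20 * \<theta> / r) * norm (y - z)"
proof -
  have *: "norm (g' y - g' z) \<le> (12 * \<eta> / r\<^sup>2 + 20 * \<theta> / r) * norm (y - z)" if y: "norm y \<le> r" for y z
  proof (rule norm_blinfun_bound)
    show "0 \<le> (12 * \<eta> / r\<^sup>2 + 20 * \<theta> / r) * norm (y - z)" using nonneg r by simp
    fix h
    let ?q = "\<lambda>y. \<sigma> y *\<^sub>R y"
    let ?a = "((\<sigma> y)\<^sup>2 - (\<sigma> z)\<^sup>2) *\<^sub>R A h"
    let ?b = "(4 / r\<^sup>2 * inner (?q y - ?q z) h) *\<^sub>R (e + A y)"
    let ?c = "(4 / r\<^sup>2 * inner (?q z) h) *\<^sub>R A (y - z)"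
    have eq: "(g' y - g' z) h = ?a - ?b - ?c"
      by (simp only: blinfun.diff_left blinfun.diff_right g'_apply inner_diff_left) (simp add: algebra_simps)
    have "\<bar>(\<sigma> y)\<^sup>2 - (\<sigma> z)\<^sup>2\<bar> = \<bar>\<sigma> y - \<sigma> z\<bar> * \<bar>\<sigma> y + \<sigma> z\<bar>"
      by (simp add: power2_eq_square algebra_simps flip: abs_mult)
    also have "\<dots> \<le> (2 / r * norm (y - z)) * 2"
      using \<sigma>_lipschitz[of y z] \<sigma>_range[of y] \<sigma>_range[of z] r by (intro mult_mono) auto
    finally have 1: "norm ?a \<le> (2 / r * norm (y - z)) * 2 * (\<theta> * norm h)"
      unfolding norm_scaleR using A_bound[of h] r by (intro mult_mono) auto
    have "\<bar>inner (?q y - ?q z) h\<bar> \<le> 3 * norm (y - z) * norm h"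
      using Cauchy_Schwarz_ineq2[of "?q y - ?q z" h]
        mult_right_mono[OF \<sigma>_scaleR_lipschitz[of y z] norm_ge_zero[of h]] by linarith
    then have "\<bar>4 / r\<^sup>2 * inner (?q y - ?q z) h\<bar> \<le> 4 / r\<^sup>2 * (3 * norm (y - z) * norm h)"
      unfolding abs_mult by (intro mult_mono) auto
    then have 2: "norm ?b \<le> 4 / r\<^sup>2 * (3 * norm (y - z) * norm h) * (\<eta> + \<theta> * r)"
      unfolding norm_scaleR using affine_bound[OF y] by (intro mult_mono) auto
    have "\<bar>inner (?q z) h\<bar> \<le> r * norm h"
      using Cauchy_Schwarz_ineq2[of "?q z" h] mult_right_mono[OF \<sigma>_scaleR_bound[of z] norm_ge_zero[of h]]
      by linarith
    then have "\<bar>4 / r\<^sup>2 * inner (?q z) h\<bar> \<le> 4 / r\<^sup>2 * (r * norm h)"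
      unfolding abs_mult by (intro mult_mono) auto
    then have 3: "norm ?c \<le> 4 / r\<^sup>2 * (r * norm h) * (\<theta> * norm (y - z))"
      unfolding norm_scaleR using A_bound[of "y - z"] r by (intro mult_mono) auto
    have "norm ((g' y - g' z) h) \<le> norm ?a + norm ?b + norm ?c"
      unfolding eq using norm_triangle_ineq4[of "?a - ?b" ?c] norm_triangle_ineq4[of ?a ?b] by linarith
    also have "\<dots> \<le> (2 / r * norm (y - z)) * 2 * (\<theta> * norm h)
        + 4 / r\<^sup>2 * (3 * norm (y - z) * norm h) * (\<eta> + \<theta> * r)
        + 4 / r\<^sup>2 * (r * norm h) * (\<theta> * norm (y - z))"
      using 1 2 3 by linarith
    also have "\<dots> = (12 * \<eta> / r\<^sup>2 + 20 * \<theta> / r) * norm (y - z) * norm h"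
      using r by (simp add: field_simps power2_eq_square)
    finally show "norm ((g' y - g' z) h) \<le> (12 * \<eta> / r\<^sup>2 + 20 * \<theta> / r) * norm (y - z) * norm h" .
  qed
  have zero: "norm (g' y - g' z) = 0" if "r \<le> norm y" "r \<le> norm z"
    using that by (simp add: g'_outside)
  have nn: "0 \<le> (12 * \<eta> / r\<^sup>2 + 20 * \<theta> / r) * norm (y - z)" using nonneg r by simp
  consider "norm z \<le> r" | "norm y \<le> r" | "r \<le> norm y" "r \<le> norm z" by linarith
  then show ?thesis
  proof cases
    case 1
    then show ?thesis using *[of z y] by (metis norm_minus_commute)
  next
    case 2
    then show ?thesis by (rule *)
  next
    case 3
    then show ?thesis using zero nn by linarith
  qed
qed

lemma g_outside: "r \<le> norm y \<Longrightarrow> g y = 0"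
  using \<sigma>_outside by (simp add: g_def)

lemma g_centre: "g 0 = e"
  by (simp add: g_def \<sigma>_def)

lemma g'_centre: "g' 0 = A"
  by (intro blinfun_eqI) (simp add: g'_apply \<sigma>_def)

end

text \<open>Counting only the terms that may be nonzero keeps the bounds for the sum of bumps
  independent of the number of sample points.\<close>

lemma norm_sum_le_card:
  fixes f :: "'a \<Rightarrow> 'b::real_normed_vector"
  assumes "finite P" "S \<subseteq> P" "card S \<le> k" "0 \<le> B"
    and "\<And>p. p \<in> P - S \<Longrightarrow> f p = 0" "\<And>p. p \<in> P \<Longrightarrow> norm (f p) \<le> B"
  shows "norm (sum f P) \<le> real k * B"
proof -
  have "sum f P = sum f S"
    using assms by (intro sum.mono_neutral_right) auto
  also have "norm \<dots> \<le> real (card S) * B"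
    using assms by (intro sum_norm_bound) auto
  also have "\<dots> \<le> real k * B"
    using assms by (intro mult_right_mono) auto
  finally show ?thesis .
qed

section \<open>The interpolating manifold\<close>

text \<open>The centres are at least \<open>2 * r\<close> apart, so at most one bump is active at
  each point. Size bounds are therefore those of a single bump, while the Lipschitz bound compares
  two points and doubles.\<close>

lemma interpolating_perturbation:
  fixes c e :: "'i \<Rightarrow> fseq" and A :: "'i \<Rightarrow> fseq \<Rightarrow>\<^sub>L fseq"
  assumes "finite P" and r: "0 < r" and nonneg: "0 \<le> \<eta>" "0 \<le> \<theta>"
    and sep: "\<And>p q. p \<in> P \<Longrightarrow> q \<in> P \<Longrightarrow> p \<noteq> q \<Longrightarrow> 2 * r \<le> norm (c p - c q)"
    and e: "\<And>p. p \<in> P \<Longrightarrow> norm (e p) \<le> \<eta>" and A: "\<And>p. p \<in> P \<Longrightarrow> norm (A p) \<le> \<theta>"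
    and eucl: "\<And>p. p \<in> P \<Longrightarrow> c p \<in> eucl D" "\<And>p. p \<in> P \<Longrightarrow> e p \<in> eucl D"
      "\<And>p x. p \<in> P \<Longrightarrow> x \<in> eucl D \<Longrightarrow> A p x \<in> eucl D"
    and small: "5 * \<theta> + 4 * \<eta> / r \<le> 1/10"
  obtains G G' where "small_perturbation D G G' (2 * (12 * \<eta> / r\<^sup>2 + 20 * \<theta> / r))"
    "\<And>x. norm (G x) \<le> \<eta> + \<theta> * r"
    "\<And>x. (\<And>p. p \<in> P \<Longrightarrow> r \<le> norm (x - c p)) \<Longrightarrow> G x = 0"
    "\<And>p. p \<in> P \<Longrightarrow> G (c p) = e p" "\<And>p. p \<in> P \<Longrightarrow> G' (c p) = A p"
proof -
  have bump: "bump r (e p) (A p) \<eta> \<theta>" if "p \<in> P" for p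
    using r e[OF that] A[OF that] by unfold_locales
  define f where "f p x = bump.g r (e p) (A p) (x - c p)" for p x
  define f' where "f' p x = bump.g' r (e p) (A p) (x - c p)" for p x
  define N where "N x = {p \<in> P. norm (x - c p) < r}" for x
  define G where "G x = (\<Sum>p\<in>P. f p x)" for x
  define G' where "G' x = (\<Sum>p\<in>P. f' p x)" for x
  have N: "N x \<subseteq> P" "card (N x) \<le> 1" for x
  proof -
    have "p = q" if "p \<in> N x" "q \<in> N x" for p q
    proof (rule ccontr)
      assume "p \<noteq> q"
      then have "2 * r \<le> norm (c p - c q)" using sep that by (auto simp: N_def)
      also have "\<dots> \<le> norm (x - c q) + norm (x - c p)"
        using norm_triangle_ineq4[of "x - c q" "x - c p"] by simp
      finally show False using that by (auto simp: N_def)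
    qed
    moreover show "N x \<subseteq> P" by (auto simp: N_def)
    ultimately show "card (N x) \<le> 1"
      using \<open>finite P\<close> card_le_Suc0_iff_eq[of "N x"] finite_subset by fastforce
  qed
  have out: "f p x = 0" "f' p x = 0" if "p \<in> P - N x" for p x
    using bump.g_outside[OF bump] bump.g'_outside[OF bump] that by (auto simp: f_def f'_def N_def)
  have B: "norm (G x) \<le> \<eta> + \<theta> * r" for x
    using norm_sum_le_card[OF \<open>finite P\<close> N, of "\<eta> + \<theta> * r" x "\<lambda>p. f p x"] nonneg r out
      bump.g_bound[OF bump] by (simp add: G_def f_def)
  have B': "norm (G' x) \<le> 5 * \<theta> + 4 * \<eta> / r" for x
    using norm_sum_le_card[OF \<open>finite P\<close> N, of "5 * \<theta> + 4 * \<eta> / r" x "\<lambda>p. f' p x"] nonneg r out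
      bump.g'_bound[OF bump] by (simp add: G'_def f'_def)
  have L: "norm (G' x - G' y) \<le> 2 * (12 * \<eta> / r\<^sup>2 + 20 * \<theta> / r) * norm (x - y)" for x y
  proof -
    have "norm (\<Sum>p\<in>P. f' p x - f' p y) \<le> real 2 * ((12 * \<eta> / r\<^sup>2 + 20 * \<theta> / r) * norm (x - y))"
    proof (rule norm_sum_le_card[OF \<open>finite P\<close>])
      show "N x \<union> N y \<subseteq> P" using N by auto
      show "card (N x \<union> N y) \<le> 2"
        using card_Un_le[of "N x" "N y"] N(2)[of x] N(2)[of y] by linarith
      show "0 \<le> (12 * \<eta> / r\<^sup>2 + 20 * \<theta> / r) * norm (x - y)" using nonneg r by simp
      show "f' p x - f' p y = 0" if "p \<in> P - (N x \<union> N y)" for p using that out by simp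
      show "norm (f' p x - f' p y) \<le> (12 * \<eta> / r\<^sup>2 + 20 * \<theta> / r) * norm (x - y)" if "p \<in> P" for p
        using bump.g'_lipschitz[OF bump[OF that], of "x - c p" "y - c p"] by (simp add: f'_def)
    qed
    then show ?thesis by (simp only: G'_def sum_subtractf of_nat_numeral mult.assoc)
  qed
  \<comment> \<open>The values are left in an arbitrary real vector space since this is applied both
    to displacements and to their derivatives.\<close>
  have only: "sum h P = h p" if "p \<in> P" "\<And>q. q \<in> P - N (c p) \<Longrightarrow> h q = 0" for p and h :: "'i \<Rightarrow> 'b::real_vector"
  proof -
    have "{p} \<subseteq> N (c p)" using that(1) r by (simp add: N_def)
    moreover have "finite (N (c p))" using N(1) \<open>finite P\<close> by (rule finite_subset)
    ultimately have "N (c p) = {p}"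
      using N(2)[of "c p"] card_seteq[of "N (c p)" "{p}"] by simp
    then have "sum h {p} = sum h P"
      using that \<open>finite P\<close> by (intro sum.mono_neutral_left) auto
    then show ?thesis by simp
  qed
  show ?thesis
  proof (rule that)
    show "small_perturbation D G G' (2 * (12 * \<eta> / r\<^sup>2 + 20 * \<theta> / r))"
    proof
      fix x y
      show "x \<in> eucl D \<Longrightarrow> G x \<in> eucl D"
        unfolding G_def f_def
        by (intro eucl_sum) (auto simp: bump.g_def[OF bump] intro!: eucl_scale eucl_add eucl_diff eucl)
      have "(f p has_derivative blinfun_apply (f' p x)) (at x)" if "p \<in> P" for p
      proof -
        have "((\<lambda>x. x - c p) has_derivative (\<lambda>h. h)) (at x)"
          by (auto intro!: derivative_eq_intros)
        from has_derivative_compose[OF this bump.g_deriv[OF bump[OF that]]]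
        show ?thesis unfolding f_def[abs_def] f'_def by simp
      qed
      then have "((\<lambda>x. \<Sum>p\<in>P. f p x) has_derivative (\<lambda>h. \<Sum>p\<in>P. f' p x h)) (at x)"
        by (rule has_derivative_sum)
      moreover have "(\<lambda>h. \<Sum>p\<in>P. f' p x h) = blinfun_apply (G' x)"
        by (simp add: G'_def blinfun.sum_left fun_eq_iff)
      ultimately show "(G has_derivative blinfun_apply (G' x)) (at x)"
        unfolding G_def[abs_def] by simp
      show "norm (G' x) \<le> 1 / 10"
        using B'[of x] small by simp
      show "norm (G' x - G' y) \<le> 2 * (12 * \<eta> / r\<^sup>2 + 20 * \<theta> / r) * norm (x - y)"
        by (rule L)
    qed
    show "norm (G x) \<le> \<eta> + \<theta> * r" for x by (rule B)
    show "G x = 0" if "\<And>p. p \<in> P \<Longrightarrow> r \<le> norm (x - c p)" for x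
      unfolding G_def using that out by (intro sum.neutral) (force simp: N_def not_less)
    fix p assume p: "p \<in> P"
    show "G (c p) = e p"
      using only[OF p, of "\<lambda>q. f q (c p)"] out bump.g_centre[OF bump[OF p]] by (simp add: G_def f_def)
    show "G' (c p) = A p"
      using only[OF p, of "\<lambda>q. f' q (c p)"] out bump.g'_centre[OF bump[OF p]] by (simp add: G'_def f'_def)
  qed
qed

section \<open>Distances under displacement, nearest points and alignment of subspaces\<close>

lemma edist_le: "a \<in> A \<Longrightarrow> edist x A \<le> ereal (dist x a)"
  unfolding edist_def by (rule INF_lower)

text \<open>The triangle inequality is used in both directions. For empty \<open>K\<close> or
  \<open>M\<close> the distances compared are infinite on both sides.\<close>

lemma hausdorff_dist_image_le:
  assumes f: "\<And>x. x \<in> M \<Longrightarrow> dist (f x) x \<le> b"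
  shows "hausdorff_dist M K \<le> hausdorff_dist (f ` M) K + ereal b"
proof -
  have "edist x K \<le> hausdorff_dist (f ` M) K + ereal b" if x: "x \<in> M" for x
  proof -
    have "edist x K \<le> edist (f x) K + ereal b"
    proof (cases "K = {}")
      case False
      have "infdist x K \<le> infdist (f x) K + b"
        using infdist_triangle[of x K "f x"] f[OF x] by (simp add: dist_commute)
      then show ?thesis using False by (simp add: edist_eq_infdist)
    qed (simp add: edist_def top_ereal_def)
    also have "edist (f x) K \<le> hausdorff_dist (f ` M) K"
      unfolding hausdorff_dist_def using x by (intro max.coboundedI1 SUP_upper) auto
    finally show ?thesis by (simp add: add_right_mono)
  qed
  moreover have "edist k M \<le> hausdorff_dist (f ` M) K + ereal b" if k: "k \<in> K" for k
  proof -
    have "edist k M \<le> edist k (f ` M) + ereal b"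
    proof (cases "M = {}")
      case False
      have "infdist k M - b \<le> dist k (f x)" if "x \<in> M" for x
        using infdist_le[OF that, of k] dist_triangle[of k x "f x"] f[OF that] by linarith
      then have "infdist k M - b \<le> infdist k (f ` M)"
        unfolding infdist_notempty[OF image_is_empty[THEN Not_eq_iff[THEN iffD2], THEN iffD2, OF False]]
        using False by (intro cINF_greatest) auto
      then show ?thesis using False by (simp add: edist_eq_infdist)
    qed (simp add: edist_def top_ereal_def)
    also have "edist k (f ` M) \<le> hausdorff_dist (f ` M) K"
      unfolding hausdorff_dist_def using k by (intro max.coboundedI2 SUP_upper) auto
    finally show ?thesis by (simp add: add_right_mono)
  qed
  ultimately show ?thesis
    unfolding hausdorff_dist_def[of M] by (intro max.boundedI SUP_least) auto
qed

text \<open>Compactness gives existence and the reach gives uniqueness, so the definite description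
  has a value.\<close>

lemma nearest_point:
  assumes M: "compact M" "M \<noteq> {}" "M \<subseteq> eucl D" "ereal \<rho> \<le> reach D M"
    and x: "x \<in> eucl D" "infdist x M < \<rho>"
  shows "nearest_point M x \<in> M" and "dist x (nearest_point M x) = infdist x M"
proof -
  obtain b where b: "b \<in> M" "infdist x M = dist x b"
    using compact_infdist_attained[OF M(1,2)] by metis
  have "nearest_point M x = b"
    unfolding nearest_point_def
  proof (rule the_equality)
    show "b \<in> M \<and> ereal (dist x b) = edist x M" using b M by (simp add: edist_eq_infdist)
    fix y assume "y \<in> M \<and> ereal (dist x y) = edist x M"
    then have "y \<in> M" "dist x y = infdist x M" using M(2) by (simp_all add: edist_eq_infdist)
    then show "y = b" by (rule nearest_unique[OF M x _ b(1) _ b(2)[symmetric]])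
  qed
  then show "nearest_point M x \<in> M" and "dist x (nearest_point M x) = infdist x M"
    using b by auto
qed

text \<open>\<open>A\<close> is the projection onto \<open>V\<close> minus the projection onto
  \<open>U\<close>. On \<open>U\<close> the identity plus \<open>A\<close> is the projection onto
  \<open>V\<close>, and equality of dimensions makes it onto once it is injective. That premise is
  supplied later by \<open>inj_\<Phi>'\<close>.\<close>

lemma subspace_rotation:
  assumes U: "U \<in> subspaces D d" and V: "V \<in> subspaces D d"
  obtains A :: "fseq \<Rightarrow>\<^sub>L fseq" where "norm A = subspace_angle U V" "\<And>x. A x \<in> eucl D"
    "inj (blinfun_apply (id_blinfun + A)) \<Longrightarrow> blinfun_apply (id_blinfun + A) ` U = V"
proof -
  have U': "U \<subseteq> eucl D" "subspace U" "dim U = d" and V': "V \<subseteq> eucl D" "subspace V" "dim V = d"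
    using U V by (auto simp: subspaces_def)
  define B where "B = Blinfun (\<lambda>x. orth_proj U x - orth_proj V x)"
  have B: "blinfun_apply B = (\<lambda>x. orth_proj U x - orth_proj V x)"
    unfolding B_def
    by (intro bounded_linear_Blinfun_apply bounded_linear_sub bounded_linear_orth_proj[OF U'(1,2)]
        bounded_linear_orth_proj[OF V'(1,2)])
  show ?thesis
  proof (rule that[of "- B"])
    show "norm (- B) = subspace_angle U V"
      using norm_blinfun.rep_eq[of B] by (simp only: norm_minus_cancel B subspace_angle_def)
    show "blinfun_apply (- B) x \<in> eucl D" for x
      using orth_proj_in[OF U'(1,2), of x] orth_proj_in[OF V'(1,2), of x] U' V'
      by (auto simp: blinfun.minus_left B intro!: eucl_diff)
    assume inj: "inj (blinfun_apply (id_blinfun + - B))"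
    show "blinfun_apply (id_blinfun + - B) ` U = V"
    proof (rule subspace_eq_if_dim_eq[OF _ _ V'(2,1)])
      have "blinfun_apply (id_blinfun + - B) u = orth_proj V u" if "u \<in> U" for u
        using orth_proj_id[OF U'(1,2) that] by (simp add: blinfun.diff_left B)
      then show "blinfun_apply (id_blinfun + - B) ` U \<subseteq> V"
        using orth_proj_in[OF V'(1,2)] by auto
      have lin: "linear (blinfun_apply (id_blinfun + - B))"
        by (rule bounded_linear.linear[OF blinfun.bounded_linear_right])
      show "subspace (blinfun_apply (id_blinfun + - B) ` U)"
        by (rule linear_subspace_image[OF lin U'(2)])
      show "dim (blinfun_apply (id_blinfun + - B) ` U) = dim V"
        using dim_inj_image_eucl[OF lin inj_on_subset[OF inj] U'(2,1)] U' V' by simp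
    qed
  qed
qed

text \<open>This replaces the noisy data by exact data on a nearby manifold. Here
  \<open>\<theta>\<close> bounds the operator norm directly, as it will after the estimate
  \<open>sin \<theta> \<le> \<theta>\<close>.\<close>

lemma interpolating_manifold:
  assumes M: "M \<in> manifolds D d \<rho>" and pos: "0 < \<rho>" "0 < \<epsilon>" "\<epsilon> \<le> \<rho>" "0 \<le> \<theta>" "0 \<le> \<eta>"
    and P: "finite P" "P \<subseteq> eucl D" and T: "\<And>p. p \<in> P \<Longrightarrow> T p \<in> subspaces D d"
    and \<eta>: "\<And>p. p \<in> P \<Longrightarrow> edist p M \<le> ereal \<eta>"
    and \<theta>: "\<And>p. p \<in> P \<Longrightarrow> subspace_angle (tangent_space M (nearest_point M p)) (T p) \<le> \<theta>"
    and sparse: "eps_sparse \<epsilon> P" and net: "\<And>x. x \<in> M \<Longrightarrow> edist x P \<le> ereal (2 * \<epsilon>)"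
    and small: "\<theta> \<le> \<epsilon> / (1140 * \<rho>)" "\<eta> \<le> \<epsilon>\<^sup>2 / (1140 * \<rho>)"
  obtains f where "f ` M \<in> manifolds D d (\<rho> / 4)" "P \<subseteq> f ` M"
    "\<And>p. p \<in> P \<Longrightarrow> tangent_space (f ` M) p = T p"
    "\<And>x. x \<in> M \<Longrightarrow> edist (f x) P \<le> ereal (2 * \<epsilon>)"
    "\<And>x. dist (f x) x \<le> \<epsilon>\<^sup>2 / \<rho>" "ambient_isotopic D M (f ` M)"
proof -
  have M': "submanifold D d M" "compact M" "M \<noteq> {}" "ereal \<rho> \<le> reach D M" "M \<subseteq> eucl D"
    using M by (auto simp: manifolds_def submanifold_def)
  define k where "k = \<epsilon> / \<rho>"
  have k: "0 < k" "k \<le> 1" "k * \<rho> = \<epsilon>" using pos by (auto simp: k_def)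
  have \<theta>k: "\<theta> \<le> k / 1140" and \<eta>k: "\<eta> \<le> \<epsilon> * k / 1140"
    using small by (auto simp: k_def power2_eq_square)
  have "\<epsilon> * k \<le> \<epsilon>" using k pos by simp
  then have \<eta>\<epsilon>: "\<eta> \<le> \<epsilon> / 1140" using \<eta>k by simp
  \<comment> \<open>Projecting the sample to \<open>M\<close> leaves the centres at least
    \<open>\<epsilon> - 2 * \<eta>\<close> apart, which exceeds
    \<open>\<epsilon> / 2 = 2 * r\<close>.\<close>
  define r where "r = \<epsilon> / 4"
  have r: "0 < r" using pos by (simp add: r_def)
  define c where "c = nearest_point M"
  have c: "c p \<in> M" "dist p (c p) \<le> \<eta>" if "p \<in> P" for p
  proof -
    have "infdist p M \<le> \<eta>" using \<eta>[OF that] M' by (simp add: edist_eq_infdist)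
    moreover from this have "infdist p M < \<rho>" using \<eta>\<epsilon> pos by simp
    ultimately show "c p \<in> M" "dist p (c p) \<le> \<eta>"
      using nearest_point[OF M'(2,3,5,4), of p] P that by (auto simp: c_def)
  qed
  have sep: "2 * r \<le> norm (c p - c q)" if "p \<in> P" "q \<in> P" "p \<noteq> q" for p q
  proof -
    have "ereal \<epsilon> \<le> edist p (P - {p})"
      using sparse that by (simp add: eps_sparse_def)
    also have "\<dots> \<le> ereal (dist p q)"
      using that by (intro edist_le) auto
    finally have "\<epsilon> \<le> dist p q" by simp
    moreover have "dist p q \<le> dist p (c p) + dist (c p) (c q) + dist q (c q)"
      using dist_triangle[of p q "c p"] dist_triangle[of "c p" q "c q"] by (simp add: dist_commute)
    ultimately have "\<epsilon> - 2 * \<eta> \<le> norm (c p - c q)"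
      using c[OF that(1)] c[OF that(2)] by (simp add: dist_norm)
    then show ?thesis using \<eta>\<epsilon> pos by (simp add: r_def)
  qed
  have TM: "tangent_space M (c p) \<in> subspaces D d" if "p \<in> P" for p
    using subspace_tangent_space[OF M'(1) c(1)[OF that]] dim_tangent_space[OF M'(1) c(1)[OF that]]
      tangent_space_subset_eucl[OF M'(5)] by (simp add: subspaces_def)
  have "\<exists>A :: fseq \<Rightarrow>\<^sub>L fseq. norm A \<le> \<theta> \<and> (\<forall>x. blinfun_apply A x \<in> eucl D) \<and>
      (inj (blinfun_apply (id_blinfun + A)) \<longrightarrow> blinfun_apply (id_blinfun + A) ` tangent_space M (c p) = T p)"
    if "p \<in> P" for p
    using subspace_rotation[OF TM[OF that] T[OF that]] \<theta>[OF that] unfolding c_def by metis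
  then obtain A :: "fseq \<Rightarrow> fseq \<Rightarrow>\<^sub>L fseq" where A: "\<And>p. p \<in> P \<Longrightarrow> norm (A p) \<le> \<theta>"
      "\<And>p x. p \<in> P \<Longrightarrow> blinfun_apply (A p) x \<in> eucl D"
      "\<And>p. p \<in> P \<Longrightarrow> inj (blinfun_apply (id_blinfun + A p)) \<Longrightarrow>
        blinfun_apply (id_blinfun + A p) ` tangent_space M (c p) = T p"
    by metis
  have "4 * \<eta> / r \<le> 16 * k / 1140"
    using \<eta>k pos by (simp add: r_def field_simps)
  then have small': "5 * \<theta> + 4 * \<eta> / r \<le> 1 / 10"
    using \<theta>k k by simp
  obtain G G' where G: "small_perturbation D G G' (2 * (12 * \<eta> / r\<^sup>2 + 20 * \<theta> / r))"
    "\<And>x. norm (G x) \<le> \<eta> + \<theta> * r"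
    "\<And>x. (\<And>p. p \<in> P \<Longrightarrow> r \<le> norm (x - c p)) \<Longrightarrow> G x = 0"
    "\<And>p. p \<in> P \<Longrightarrow> G (c p) = p - c p" "\<And>p. p \<in> P \<Longrightarrow> G' (c p) = A p"
    by (rule interpolating_perturbation[OF P(1) r pos(5,4) sep,
          where e = "\<lambda>p. p - c p" and A = A and D = D])
      (use A small' c M'(5) P in \<open>auto simp: dist_norm intro!: eucl_diff\<close>)
  interpret small_perturbation D G G' "2 * (12 * \<eta> / r\<^sup>2 + 20 * \<theta> / r)" by (rule G(1))
  \<comment> \<open>Here the constant 1140 is decisive: \<open>2 * (192 + 80) = 544\<close> has to
    stay below half of it.\<close>
  have R: "2 * (12 * \<eta> / r\<^sup>2 + 20 * \<theta> / r) \<le> 1 / (2 * \<rho>)"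
  proof -
    have "12 * \<eta> / r\<^sup>2 = 192 * \<eta> / \<epsilon>\<^sup>2" "20 * \<theta> / r = 80 * \<theta> / \<epsilon>"
      by (simp_all add: r_def power2_eq_square)
    moreover have "192 * \<eta> / \<epsilon>\<^sup>2 \<le> 192 / (1140 * \<rho>)"
      using small pos by (simp add: field_simps power2_eq_square)
    moreover have "80 * \<theta> / \<epsilon> \<le> 80 / (1140 * \<rho>)"
      using small pos by (simp add: field_simps)
    ultimately have "2 * (12 * \<eta> / r\<^sup>2 + 20 * \<theta> / r) \<le> 2 * (192 / (1140 * \<rho>) + 80 / (1140 * \<rho>))"
      by (intro mult_left_mono add_mono) simp_all
    also have "\<dots> \<le> 1 / (2 * \<rho>)"
      using pos by (simp add: field_simps)
    finally show ?thesis .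
  qed
  have \<Phi>p: "\<Phi> (c p) = p" if "p \<in> P" for p
    using G(4)[OF that] by (simp add: \<Phi>_def)
  have move: "\<eta> + \<theta> * r \<le> \<epsilon> * k / 4"
  proof -
    have "\<theta> * r \<le> k / 1140 * (\<epsilon> / 4)"
      using \<theta>k pos k unfolding r_def by (intro mult_mono) auto
    moreover have "0 \<le> \<epsilon> * k" using pos k by simp
    ultimately show ?thesis using \<eta>k by (simp add: mult.commute)
  qed
  show ?thesis
  proof (rule that[of \<Phi>])
    show "\<Phi> ` M \<in> manifolds D d (\<rho> / 4)"
      by (rule manifolds_image[OF M pos(1) R])
    show "P \<subseteq> \<Phi> ` M"
      using c \<Phi>p by (metis imageI subsetI)
    show "tangent_space (\<Phi> ` M) p = T p" if p: "p \<in> P" for p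
    proof -
      have "\<Phi>' (c p) = id_blinfun + A p" using G(5)[OF p] by (simp add: \<Phi>'_def)
      then show ?thesis
        using tangent_space_\<Phi>[OF M pos(1) R c(1)[OF p]] A(3)[OF p] inj_\<Phi>'[of "c p"] \<Phi>p[OF p] by simp
    qed
    \<comment> \<open>Fixed points keep their covering distance. A moved point lies within
      \<open>r\<close> of a centre, and its image is within
      \<open>\<epsilon> / 4 + \<epsilon> / 4 + \<eta>\<close> of a sample point, far below
      \<open>2 * \<epsilon>\<close>.\<close>
    show "edist (\<Phi> x) P \<le> ereal (2 * \<epsilon>)" if x: "x \<in> M" for x
    proof (cases "\<forall>p\<in>P. r \<le> norm (x - c p)")
      case True
      then have "\<Phi> x = x" using G(3) by (simp add: \<Phi>_def)
      then show ?thesis using net x by simp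
    next
      case False
      then obtain p where p: "p \<in> P" "norm (x - c p) < r" by force
      have "dist (\<Phi> x) p \<le> dist (\<Phi> x) x + dist x (c p) + dist p (c p)"
        using dist_triangle[of "\<Phi> x" p x] dist_triangle[of x p "c p"] by (simp add: dist_commute)
      also have "\<dots> \<le> \<epsilon> * k / 4 + r + \<eta>"
        using G(2)[of x] move p c(2)[OF p(1)] by (simp add: \<Phi>_def dist_norm)
      also have "\<dots> \<le> 2 * \<epsilon>"
        unfolding r_def using \<open>\<epsilon> * k \<le> \<epsilon>\<close> \<eta>\<epsilon> pos by linarith
      finally show ?thesis
        using edist_le[OF p(1), of "\<Phi> x"] by (meson ereal_less_eq(3) order.trans)
    qed
    show "dist (\<Phi> x) x \<le> \<epsilon>\<^sup>2 / \<rho>" for x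
    proof -
      have "\<epsilon>\<^sup>2 / \<rho> = \<epsilon> * k" by (simp add: k_def power2_eq_square)
      moreover have "0 \<le> \<epsilon> * k" using pos k by simp
      ultimately show ?thesis using G(2)[of x] move by (simp add: \<Phi>_def dist_norm)
    qed
    show "ambient_isotopic D M (\<Phi> ` M)"
      by (rule ambient_isotopic_image)
  qed
qed

theorem theorem14:
  fixes d :: nat and \<omega> :: weights
  assumes "boissonnat_ghosh d \<omega>"
  shows "\<exists>\<epsilon>d>0. \<exists>Cd>0. \<forall>D \<rho> \<epsilon> M. 0 < \<rho> \<longrightarrow> 0 < \<epsilon> \<longrightarrow> \<epsilon> \<le> \<epsilon>d * \<rho> \<longrightarrow> M \<in> manifolds D d \<rho> \<longrightarrow>
    (\<forall>P T \<theta> \<eta>. finite P \<longrightarrow> P \<subseteq> eucl D \<longrightarrow> T \<in> P \<rightarrow>\<^sub>E subspaces D d \<longrightarrow> 0 \<le> \<theta> \<longrightarrow> 0 \<le> \<eta> \<longrightarrow>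
      (\<forall>p\<in>P. edist p M \<le> ereal \<eta>) \<longrightarrow>
      (\<forall>p\<in>P. subspace_angle (tangent_space M (nearest_point M p)) (T p) \<le> sin \<theta>) \<longrightarrow>
      eps_sparse \<epsilon> P \<longrightarrow>
      (\<forall>x\<in>M. edist x P \<le> ereal (2 * \<epsilon>)) \<longrightarrow>
      \<theta> \<le> \<epsilon> / (1140 * \<rho>) \<longrightarrow> \<eta> \<le> \<epsilon>\<^sup>2 / (1140 * \<rho>) \<longrightarrow>
      hausdorff_dist M (carrier_of (tdel D P T (\<omega> D P T))) \<le> ereal (Cd * \<epsilon>\<^sup>2 / \<rho>) \<and>
      ambient_isotopic D M (carrier_of (tdel D P T (\<omega> D P T))))"
proof -
  obtain \<epsilon>' C' where pos: "0 < \<epsilon>'" "0 < C'" and bg: "\<And>D \<rho> \<epsilon> M P T.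
        0 < \<rho> \<Longrightarrow> 0 < \<epsilon> \<Longrightarrow> \<epsilon> \<le> \<epsilon>' * \<rho> \<Longrightarrow> M \<in> manifolds D d \<rho> \<Longrightarrow>
        finite P \<Longrightarrow> P \<subseteq> M \<Longrightarrow> eps_sparse \<epsilon> P \<Longrightarrow> (SUP x\<in>M. edist x P) \<le> ereal (2 * \<epsilon>) \<Longrightarrow>
        T = (\<lambda>p\<in>P. tangent_space M p) \<Longrightarrow>
        hausdorff_dist M (carrier_of (tdel D P T (\<omega> D P T))) \<le> ereal (C' * \<epsilon>\<^sup>2 / \<rho>) \<and>
        ambient_isotopic D M (carrier_of (tdel D P T (\<omega> D P T)))"
    using assms unfolding boissonnat_ghosh_def by metis
  show ?thesis
  proof (rule exI[of _ "min 1 (\<epsilon>' / 4)"], intro exI[of _ "4 * C' + 1"] conjI allI impI)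
    show "0 < min 1 (\<epsilon>' / 4)" "0 < 4 * C' + 1" using pos by auto
    fix D \<rho> \<epsilon> M P T \<theta> \<eta>
    assume \<rho>: "0 < (\<rho>::real)" and \<epsilon>: "0 < \<epsilon>" "\<epsilon> \<le> min 1 (\<epsilon>' / 4) * \<rho>" and M: "M \<in> manifolds D d \<rho>"
      and P: "finite P" "P \<subseteq> eucl D" and T: "T \<in> P \<rightarrow>\<^sub>E subspaces D d" and nn: "0 \<le> \<theta>" "0 \<le> \<eta>"
      and \<eta>: "\<forall>p\<in>P. edist p M \<le> ereal \<eta>"
      and \<theta>: "\<forall>p\<in>P. subspace_angle (tangent_space M (nearest_point M p)) (T p) \<le> sin \<theta>"
      and sparse: "eps_sparse \<epsilon> P" and net: "\<forall>x\<in>M. edist x P \<le> ereal (2 * \<epsilon>)"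
      and small: "\<theta> \<le> \<epsilon> / (1140 * \<rho>)" "\<eta> \<le> \<epsilon>\<^sup>2 / (1140 * \<rho>)"
    let ?K = "carrier_of (tdel D P T (\<omega> D P T))"
    have \<epsilon>\<rho>: "\<epsilon> \<le> \<rho>" "\<epsilon> \<le> \<epsilon>' * (\<rho> / 4)"
    proof -
      have "min 1 (\<epsilon>' / 4) * \<rho> \<le> 1 * \<rho>" "min 1 (\<epsilon>' / 4) * \<rho> \<le> \<epsilon>' / 4 * \<rho>"
        using \<rho> by (intro mult_right_mono min.cobounded1 min.cobounded2; simp)+
      then show "\<epsilon> \<le> \<rho>" "\<epsilon> \<le> \<epsilon>' * (\<rho> / 4)" using \<epsilon> by linarith+
    qed
    have "subspace_angle (tangent_space M (nearest_point M p)) (T p) \<le> \<theta>" if "p \<in> P" for p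
      using \<theta> that sin_x_le_x[OF nn(1)] by (meson order.trans)
    from interpolating_manifold[OF M \<rho> \<epsilon>(1) \<epsilon>\<rho>(1) nn P PiE_mem[OF T] bspec[OF \<eta>] this sparse
        bspec[OF net] small]
    obtain f where f: "f ` M \<in> manifolds D d (\<rho> / 4)" "P \<subseteq> f ` M"
      "\<And>p. p \<in> P \<Longrightarrow> tangent_space (f ` M) p = T p"
      "\<And>x. x \<in> M \<Longrightarrow> edist (f x) P \<le> ereal (2 * \<epsilon>)"
      "\<And>x. dist (f x) x \<le> \<epsilon>\<^sup>2 / \<rho>" "ambient_isotopic D M (f ` M)"
      by blast
    \<comment> \<open>The weights depend on \<open>T\<close> as a function, so equality on
      \<open>P\<close> is not enough. Outside \<open>P\<close> both families take the default value
      of extensional functions.\<close>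
    have "T p = restrict (tangent_space (f ` M)) P p" for p
      by (cases "p \<in> P") (simp_all add: f(3) PiE_arb[OF T])
    then have "T = (\<lambda>p\<in>P. tangent_space (f ` M) p)"
      by (rule ext)
    moreover have "(SUP x\<in>f ` M. edist x P) \<le> ereal (2 * \<epsilon>)"
      using f(4) by (intro SUP_least) auto
    ultimately have K: "hausdorff_dist (f ` M) ?K \<le> ereal (C' * \<epsilon>\<^sup>2 / (\<rho> / 4))"
        "ambient_isotopic D (f ` M) ?K"
      using bg[of "\<rho> / 4" \<epsilon> "f ` M" D P T] \<rho> \<epsilon> \<epsilon>\<rho> f P sparse by auto
    have "hausdorff_dist M ?K \<le> hausdorff_dist (f ` M) ?K + ereal (\<epsilon>\<^sup>2 / \<rho>)"
      by (rule hausdorff_dist_image_le[OF f(5)])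
    also have "\<dots> \<le> ereal (C' * \<epsilon>\<^sup>2 / (\<rho> / 4)) + ereal (\<epsilon>\<^sup>2 / \<rho>)"
      by (rule add_right_mono[OF K(1)])
    also have "\<dots> = ereal ((4 * C' + 1) * \<epsilon>\<^sup>2 / \<rho>)"
      using \<rho> by (simp add: field_simps)
    finally show "hausdorff_dist M ?K \<le> ereal ((4 * C' + 1) * \<epsilon>\<^sup>2 / \<rho>)" .
    have "M \<subseteq> eucl D" using M by (auto simp: manifolds_def submanifold_def)
    then show "ambient_isotopic D M ?K"
      by (rule ambient_isotopic_trans[OF _ f(6) K(2)])
  qed
qed

end
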